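(* Let $n\ge 1$ be relatively prime to $p$. The group $U=\{a\in A_n: aa^*=1\}$ is the (internal) direct product of a cyclic subgroup of order $q+1$ and the cyclic subgroups $H_{i,l}$, where $l$ runs over $1,\dots,t$ and $i$ runs over the integers with $1\le i\le n-1$ that are relatively prime to $p$.
   Context: Let $k$ be a finite field with $q=p^t$ elements, $p$ an odd prime, and let $K$ be its quadratic extension; fix $\Delta\in K$ with $K=k(\Delta)$ and $\Delta^2\in k$, and let $\overline{a+b\Delta}=a-b\Delta$ ($a,b\in k$). Let $A_n=K[x]/\langle x^n\rangle$, with involution $\left(\sum_{i} a_ix^i\right)^*=\sum_{i}(-1)^i\overline{a_i}x^i$. Fix a basis $e_1,\dots,e_t$ of $k$ over $\mathbb F_p$. For $1\le i\le n-1$ with $i$ relatively prime to $p$ and $1\le l\le t$, $H_{i,l}$ is the cyclic subgroup of $U_0=\{b\in A_n: bb^*=1,\ b \text{ has constant term } 1\}$ generated by $$z=1+\alpha_1x^{i}+\alpha_2x^{2i}+\cdots+\alpha_{m}x^{mi}\ \ (i\text{ odd}),\qquad z=1+\alpha_1\Delta x^{i}+\alpha_2\Delta^2x^{2i}+\cdots+\alpha_{m}\Delta^{m}x^{mi}\ \ (i\text{ even}),$$ where $m$ is the integer with $mi<n\le (m+1)i$, and the $\alpha_j\in k$ are defined by $\alpha_1=e_l$, $\alpha_2=\tfrac12\alpha_1^2$, $\alpha_j=0$ for odd $j\ge 3$, and, for even $j\ge 4$, $2\alpha_j+\sum_{s=1}^{j/2-1}\alpha_{2s}\alpha_{j-2s}=0$.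 *)

theory Defs
  imports "HOL-Algebra.Algebra"
begin

definition quad_conj :: "('a, 'b) ring_scheme \<Rightarrow> 'a set \<Rightarrow> 'a \<Rightarrow> 'a \<Rightarrow> 'a"
  where "quad_conj K k \<Delta> z =
    (THE w. \<exists>a\<in>k. \<exists>b\<in>k. z = a \<oplus>\<^bsub>K\<^esub> b \<otimes>\<^bsub>K\<^esub> \<Delta> \<and> w = a \<ominus>\<^bsub>K\<^esub> b \<otimes>\<^bsub>K\<^esub> \<Delta>)"

definition x_ideal :: "('a, 'b) ring_scheme \<Rightarrow> nat \<Rightarrow> (nat \<Rightarrow> 'a) set"
  where "x_ideal K n = genideal (UP K) {monom (UP K) \<one>\<^bsub>K\<^esub> n}"

definition trunc_ring :: "('a, 'b) ring_scheme \<Rightarrow> nat \<Rightarrow> (nat \<Rightarrow> 'a) set ring"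
  where "trunc_ring K n = UP K Quot x_ideal K n"

definition poly_star ::
  "('a, 'b) ring_scheme \<Rightarrow> 'a set \<Rightarrow> 'a \<Rightarrow> (nat \<Rightarrow> 'a) \<Rightarrow> (nat \<Rightarrow> 'a)"
  where "poly_star K k \<Delta> f =
    (\<lambda>i. if even i then quad_conj K k \<Delta> (coeff (UP K) f i)
         else \<ominus>\<^bsub>K\<^esub> quad_conj K k \<Delta> (coeff (UP K) f i))"

text \<open>Elements of \<^const>\<open>trunc_ring\<close> are cosets of the ideal generated by \<open>x\<^sup>n\<close>. The map
  \<^const>\<open>poly_star\<close> is an additive bijection preserving this ideal, so the image of the coset of
  \<open>f\<close> is the coset of \<open>f\<^sup>*\<close>.\<close>

definition trunc_star ::
  "('a, 'b) ring_scheme \<Rightarrow> 'a set \<Rightarrow> 'a \<Rightarrow> (nat \<Rightarrow> 'a) set \<Rightarrow> (nat \<Rightarrow> 'a) set"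
  where "trunc_star K k \<Delta> a = poly_star K k \<Delta> ` a"

definition unitary_group ::
  "('a, 'b) ring_scheme \<Rightarrow> 'a set \<Rightarrow> 'a \<Rightarrow> nat \<Rightarrow> (nat \<Rightarrow> 'a) set monoid"
  where "unitary_group K k \<Delta> n =
    \<lparr>carrier = {a \<in> carrier (trunc_ring K n).
        a \<otimes>\<^bsub>trunc_ring K n\<^esub> trunc_star K k \<Delta> a = \<one>\<^bsub>trunc_ring K n\<^esub>},
     monoid.mult = monoid.mult (trunc_ring K n),
     one = one (trunc_ring K n)\<rparr>"

text \<open>For \<open>n \<ge> 1\<close> all representatives of a coset have the same constant term.\<close>

definition unitary_group0 ::
  "('a, 'b) ring_scheme \<Rightarrow> 'a set \<Rightarrow> 'a \<Rightarrow> nat \<Rightarrow> (nat \<Rightarrow> 'a) set monoid"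
  where "unitary_group0 K k \<Delta> n = (unitary_group K k \<Delta> n)
    \<lparr>carrier := {b \<in> carrier (unitary_group K k \<Delta> n).
        \<exists>f\<in>b. coeff (UP K) f 0 = \<one>\<^bsub>K\<^esub>}\<rparr>"

text \<open>Only the values of \<open>\<alpha>\<close> at indices \<open>j \<ge> 1\<close> are constrained.\<close>

definition alpha_seq ::
  "('a, 'b) ring_scheme \<Rightarrow> 'a set \<Rightarrow> 'a \<Rightarrow> (nat \<Rightarrow> 'a) \<Rightarrow> bool"
  where "alpha_seq K k a \<alpha> \<longleftrightarrow>
    (\<forall>j\<ge>1. \<alpha> j \<in> k) \<and>
    \<alpha> 1 = a \<and>
    \<alpha> 2 = inv\<^bsub>K\<^esub> (\<one>\<^bsub>K\<^esub> \<oplus>\<^bsub>K\<^esub> \<one>\<^bsub>K\<^esub>) \<otimes>\<^bsub>K\<^esub> \<alpha> 1 [^]\<^bsub>K\<^esub> (2::nat) \<and>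
    (\<forall>j\<ge>3. odd j \<longrightarrow> \<alpha> j = \<zero>\<^bsub>K\<^esub>) \<and>
    (\<forall>j\<ge>4. even j \<longrightarrow>
      (\<one>\<^bsub>K\<^esub> \<oplus>\<^bsub>K\<^esub> \<one>\<^bsub>K\<^esub>) \<otimes>\<^bsub>K\<^esub> \<alpha> j \<oplus>\<^bsub>K\<^esub>
        (\<Oplus>\<^bsub>K\<^esub>s\<in>{1..j div 2 - 1}. \<alpha> (2 * s) \<otimes>\<^bsub>K\<^esub> \<alpha> (j - 2 * s)) = \<zero>\<^bsub>K\<^esub>)"

definition z_gen ::
  "('a, 'b) ring_scheme \<Rightarrow> 'a \<Rightarrow> nat \<Rightarrow> (nat \<Rightarrow> 'a) \<Rightarrow> nat \<Rightarrow> (nat \<Rightarrow> 'a) set"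
  where "z_gen K \<Delta> n \<alpha> i =
    (let m = (THE m. m * i < n \<and> n \<le> (m + 1) * i)
     in x_ideal K n +>\<^bsub>UP K\<^esub>
       (\<one>\<^bsub>UP K\<^esub> \<oplus>\<^bsub>UP K\<^esub>
        (\<Oplus>\<^bsub>UP K\<^esub>j\<in>{1..m}.
           monom (UP K) (if odd i then \<alpha> j else \<alpha> j \<otimes>\<^bsub>K\<^esub> \<Delta> [^]\<^bsub>K\<^esub> j) (j * i))))"

definition H_subgroup ::
  "('a, 'b) ring_scheme \<Rightarrow> 'a set \<Rightarrow> 'a \<Rightarrow> nat \<Rightarrow> (nat \<Rightarrow> 'a) \<Rightarrow> nat \<Rightarrow> (nat \<Rightarrow> 'a) set set"
  where "H_subgroup K k \<Delta> n \<alpha> i = generate (unitary_group0 K k \<Delta> n) {z_gen K \<Delta> n \<alpha> i}"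

definition internal_direct_product ::
  "('g, 'm) monoid_scheme \<Rightarrow> 'i set \<Rightarrow> ('i \<Rightarrow> 'g set) \<Rightarrow> bool"
  where "internal_direct_product G I H \<longleftrightarrow>
    group G \<and>
    (\<forall>i\<in>I. H i \<lhd> G) \<and>
    generate G (\<Union>i\<in>I. H i) = carrier G \<and>
    (\<forall>i\<in>I. H i \<inter> generate G (\<Union>j\<in>I - {i}. H j) = {\<one>\<^bsub>G\<^esub>})"

end

theory Submission
  imports Defs
begin

text \<open>
  Filter \<open>U\<close> by the subgroups \<open>W j\<close> of elements congruent to \<open>1\<close> modulo \<open>x\<^sup>j\<close>. For \<open>1 \<le> j < n\<close>
  taking the coefficient of \<open>x\<^sup>j\<close> is a homomorphism from \<open>W j\<close> to the additive group of \<open>K\<close> with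
  kernel \<open>W (j + 1)\<close>, and its values lie in \<open>k\<close> for odd \<open>j\<close> and in \<open>k \<Delta>\<close> for even \<open>j\<close>. By the
  Frobenius identity the generator \<open>z = 1 + e\<^sub>l \<delta> x\<^sup>i + \<dots>\<close> of \<open>H\<^sub>i\<^sub>,\<^sub>l\<close> (with \<open>\<delta> = 1\<close> or \<open>\<delta> = \<Delta>\<close>) has
  \<open>p\<^sup>r\<close>-th power with leading term \<open>(e\<^sub>l \<delta>)\<close> raised to \<open>p\<^sup>r\<close>, in degree \<open>i p\<^sup>r\<close>. Every \<open>j\<close> is uniquely
  \<open>i p\<^sup>r\<close> with \<open>i\<close> prime to \<open>p\<close>, and these leading coefficients, \<open>l = 1, \<dots>, t\<close>, form a basis over the
  prime field of the possible values in degree \<open>j\<close>, because Frobenius permutes \<open>k\<close>. Spanning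
  gives generation of \<open>W 1\<close> by descending induction on \<open>j\<close>; independence shows, level by level, that a
  product of elements of the \<open>H\<^sub>i\<^sub>,\<^sub>l\<close> is trivial only if every factor is. The complement of \<open>W 1\<close>
  is the norm-one group of \<open>K\<close>, generated by \<open>g\<close> to the power \<open>q - 1\<close> for \<open>g\<close> primitive, since
  conjugation is the \<open>q\<close>-th power map.
\<close>

section \<open>Frobenius maps and internal direct products\<close>

text \<open>Induction on the exponent: multiplying the expansion by \<open>x\<close> and by
  \<open>y\<close> gives two sums that differ by an index shift, and Pascal's rule merges
  them.\<close>

lemma (in cring) binomial:
  assumes x: "x \<in> carrier R" and y: "y \<in> carrier R"
  shows "(x \<oplus> y) [^] (n::nat) = (\<Oplus>i\<in>{..n}. add_pow R (n choose i) (x [^] i \<otimes> y [^] (n - i)))"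
proof (induction n)
  case 0
  then show ?case by (simp add: assms)
next
  case (Suc n)
  let ?t = "\<lambda>i. x [^] i \<otimes> y [^] (Suc n - i)"
  let ?f = "\<lambda>i. add_pow R (n choose i) (x [^] i \<otimes> y [^] (n - i))"
  have tc: "?t i \<in> carrier R" for i using assms by simp
  have fc: "?f \<in> {..n} \<rightarrow> carrier R" using assms by auto
  have fy: "?f i \<otimes> y = add_pow R (n choose i) (?t i)" if "i \<le> n" for i
    using that assms by (simp add: add_pow_ldistr m_assoc Suc_diff_le nat_pow_Suc)
  have fx: "?f i \<otimes> x = add_pow R (n choose i) (?t (Suc i))" if "i \<le> n" for i
  proof -
    have "x [^] i \<otimes> y [^] (n - i) \<otimes> x = ?t (Suc i)"
      using that assms by (simp add: nat_pow_Suc m_ac)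
    then show ?thesis using assms by (simp add: add_pow_ldistr)
  qed
  have "(x \<oplus> y) [^] Suc n = (\<Oplus>i\<in>{..n}. ?f i) \<otimes> x \<oplus> (\<Oplus>i\<in>{..n}. ?f i) \<otimes> y"
    using assms by (simp add: Suc nat_pow_Suc r_distr fc)
  also have "(\<Oplus>i\<in>{..n}. ?f i) \<otimes> x = (\<Oplus>i\<in>{..n}. add_pow R (n choose i) (?t (Suc i)))"
    by (subst finsum_ldistr[OF _ x fc]) (auto intro!: finsum_cong' simp: fx tc x y)
  also have "(\<Oplus>i\<in>{..n}. ?f i) \<otimes> y = (\<Oplus>i\<in>{..n}. add_pow R (n choose i) (?t i))"
    by (subst finsum_ldistr[OF _ y fc]) (auto intro!: finsum_cong' simp: fy tc x y)
  \<comment> \<open>The new top term has coefficient \<open>n choose Suc n = 0\<close>. It is added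
    so that splitting off the term at 0 leaves a sum over the same range \<open>{..n}\<close> as the
    other one.\<close>
  also have "\<dots> = (\<Oplus>i\<in>{..Suc n}. add_pow R (n choose i) (?t i))"
    by (subst finsum_Suc) (use tc in \<open>auto simp: binomial_eq_0\<close>)
  also have "\<dots> = (\<Oplus>i\<in>{..n}. add_pow R (n choose Suc i) (?t (Suc i))) \<oplus> ?t 0"
    by (subst finsum_Suc2) (use tc x y in auto)
  also have "(\<Oplus>i\<in>{..n}. add_pow R (n choose i) (?t (Suc i))) \<oplus> ((\<Oplus>i\<in>{..n}. add_pow R (n choose Suc i) (?t (Suc i))) \<oplus> ?t 0)
     = (\<Oplus>i\<in>{..n}. add_pow R (n choose i) (?t (Suc i)) \<oplus> add_pow R (n choose Suc i) (?t (Suc i))) \<oplus> ?t 0"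
    by (subst finsum_addf) (use tc x y in \<open>auto simp: a_assoc\<close>)
  also have "\<dots> = (\<Oplus>i\<in>{..n}. add_pow R (Suc n choose Suc i) (?t (Suc i))) \<oplus> ?t 0"
    by (rule arg_cong[where f = "\<lambda>u. u \<oplus> _"], rule finsum_cong')
      (use tc x y in \<open>auto simp: add.nat_pow_mult\<close>)
  also have "\<dots> = (\<Oplus>i\<in>{..Suc n}. add_pow R (Suc n choose i) (?t i))"
    by (subst finsum_Suc2[where n = n]) (use tc x y in \<open>auto\<close>)
  finally show ?case .
qed

context cring
begin

lemma add_pow_eq_zero_of_dvd:
  assumes "add_pow R (p::nat) \<one> = \<zero>" "p dvd m" "x \<in> carrier R"
  shows "add_pow R m x = \<zero>"
proof -
  obtain c where "m = p * c" using assms by auto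
  then have "add_pow R m \<one> = \<zero>"
    using assms(1) by (simp add: add.nat_pow_pow[symmetric])
  then show ?thesis using add_pow_ldistr[of \<one> x m] assms by simp
qed

text \<open>The inner binomial coefficients of a prime \<open>p\<close> are divisible by
  \<open>p\<close>, so only the two end terms survive. Commutative rings are allowed because the
  identity is applied to polynomials as well as to field elements.\<close>

lemma frobenius_add:
  assumes p: "Factorial_Ring.prime (p::nat)" and char: "add_pow R p \<one> = \<zero>"
    and x: "x \<in> carrier R" and y: "y \<in> carrier R"
  shows "(x \<oplus> y) [^] p = x [^] p \<oplus> y [^] p"
proof -
  obtain m where m: "p = Suc m" using p prime_gt_0_nat[of p] by (cases p) auto
  let ?f = "\<lambda>i. add_pow R (p choose i) (x [^] i \<otimes> y [^] (p - i))"
  have z: "?f i = \<zero>" if "0 < i" "i < p" for i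
    using that p x y by (intro add_pow_eq_zero_of_dvd[OF char] dvd_choose_prime) auto
  have "(\<Oplus>i\<in>{..m}. ?f i) = (\<Oplus>i\<in>{..m}. if 0 = i then ?f i else \<zero>)"
    by (rule finsum_cong') (use x y z m in \<open>auto simp del: nat_pow_Suc\<close>)
  also have "\<dots> = ?f 0" by (rule add.finprod_singleton) (use x y in auto)
  finally have "(\<Oplus>i\<in>{..m}. ?f i) = y [^] p" using y by simp
  moreover have "(\<Oplus>i\<in>{..p}. ?f i) = ?f p \<oplus> (\<Oplus>i\<in>{..m}. ?f i)"
    using m x y by (simp del: nat_pow_Suc)
  ultimately show ?thesis using binomial[OF x y, of p] x y by simp
qed

lemma frobenius_pow_add:
  assumes p: "Factorial_Ring.prime (p::nat)" and char: "add_pow R p \<one> = \<zero>"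
    and x: "x \<in> carrier R" and y: "y \<in> carrier R"
  shows "(x \<oplus> y) [^] (p ^ r) = x [^] (p ^ r) \<oplus> y [^] (p ^ r)"
proof (induction r)
  case (Suc r)
  have "(x \<oplus> y) [^] (p ^ Suc r) = ((x \<oplus> y) [^] (p ^ r)) [^] p"
    using x y by (simp add: nat_pow_pow mult.commute)
  also have "\<dots> = (x [^] (p ^ r)) [^] p \<oplus> (y [^] (p ^ r)) [^] p"
    using Suc frobenius_add[OF p char] x y by simp
  finally show ?case using x y by (simp add: nat_pow_pow mult.commute)
qed (use x y in auto)

lemma frobenius_pow_finsum:
  assumes p: "Factorial_Ring.prime (p::nat)" and char: "add_pow R p \<one> = \<zero>"
    and f: "f \<in> A \<rightarrow> carrier R"
  shows "(\<Oplus>i\<in>A. f i) [^] (p ^ r) = (\<Oplus>i\<in>A. f i [^] (p ^ r))"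
proof -
  \<comment> \<open>Needed for the empty sum and for infinite \<open>A\<close>, where the sum is
    \<zero> by convention.\<close>
  have z: "\<zero> [^] (p ^ r) = \<zero>"
    using p by (simp add: nat_pow_zero prime_gt_0_nat)
  show ?thesis using f
  proof (induction A rule: infinite_finite_induct)
    case (insert a A)
    then show ?case
      by (simp add: Pi_iff frobenius_pow_add[OF p char])
  qed (auto simp: z)
qed

end

section \<open>Internal direct products in commutative groups\<close>

lemma (in comm_group) generate_UN_subgroups:
  fixes J :: "'i set"
  assumes J: "finite J" and H: "\<And>j. j \<in> J \<Longrightarrow> subgroup (H j) G"
  shows "generate G (\<Union>j\<in>J. H j) = {finprod G h J | h. h \<in> Pi J H}" (is "_ = ?S")
proof (rule generateI[symmetric])
  have HG: "\<And>h. h \<in> Pi J H \<Longrightarrow> h \<in> J \<rightarrow> carrier G"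
    using H subgroup.mem_carrier by fastforce
  \<comment> \<open>Commutativity lets products and inverses of such products be taken factor by
    factor.\<close>
  show "subgroup ?S G"
  proof (rule subgroupI)
    show "?S \<subseteq> carrier G" using HG by auto
    have "finprod G (\<lambda>_. \<one>) J \<in> ?S" using H subgroup.one_closed by fastforce
    then show "?S \<noteq> {}" by blast
  next
    fix a assume "a \<in> ?S"
    then obtain h where h: "h \<in> Pi J H" "a = finprod G h J" by auto
    have "finprod G h J \<otimes> finprod G (\<lambda>j. inv h j) J = finprod G (\<lambda>j. h j \<otimes> inv h j) J"
      using HG[OF h(1)] by (subst finprod_multf) auto
    also have "\<dots> = \<one>" using HG[OF h(1)] by (intro finprod_one_eqI) (auto simp: Pi_iff)
    finally have "inv a = finprod G (\<lambda>j. inv h j) J"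
      using HG[OF h(1)] h(2) by (intro comm_inv_char) (auto intro!: finprod_closed)
    moreover have "(\<lambda>j. inv h j) \<in> Pi J H" using h H subgroup.m_inv_closed by fastforce
    ultimately show "inv a \<in> ?S" by blast
  next
    fix a b assume "a \<in> ?S" "b \<in> ?S"
    then obtain h h' where h: "h \<in> Pi J H" "a = finprod G h J" "h' \<in> Pi J H" "b = finprod G h' J"
      by auto
    then have "a \<otimes> b = finprod G (\<lambda>j. h j \<otimes> h' j) J"
      using HG by (simp add: finprod_multf)
    moreover have "(\<lambda>j. h j \<otimes> h' j) \<in> Pi J H" using h H subgroup.m_closed by fastforce
    ultimately show "a \<otimes> b \<in> ?S" by blast
  qed
  show "(\<Union>j\<in>J. H j) \<subseteq> ?S"
  proof
    fix x assume "x \<in> (\<Union>j\<in>J. H j)"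
    then obtain j where j: "j \<in> J" "x \<in> H j" by auto
    let ?h = "\<lambda>i. if j = i then x else \<one>"
    have "?h \<in> Pi J H" using j H subgroup.one_closed by fastforce
    moreover have "finprod G ?h J = x"
      using finprod_singleton[OF j(1) J, of "\<lambda>_. x"] H[OF j(1)] j subgroup.mem_carrier by fastforce
    ultimately show "x \<in> ?S" by (smt (verit) mem_Collect_eq)
  qed
  fix K assume K: "subgroup K G" "(\<Union>j\<in>J. H j) \<subseteq> K"
  have fin: "finprod G h J' \<in> K" if "h \<in> J' \<rightarrow> K" for h and J' :: "'i set"
    using that
  proof (induction J' rule: infinite_finite_induct)
    case (insert a A)
    then show ?case using K(1) subgroup.mem_carrier[OF K(1)]
      by (subst finprod_insert) (auto simp: Pi_iff subgroup.m_closed)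
  qed (use subgroup.one_closed[OF K(1)] in auto)
  have "h \<in> J \<rightarrow> K" if "h \<in> Pi J H" for h using that K(2) by blast
  with fin show "?S \<subseteq> K" by auto
qed

text \<open>The usual intersection condition follows from \<open>indep\<close>: an element of
  \<open>H j\<close> that is also a product from the other subgroups yields, once moved to the other
  side, a factorisation of the unit.\<close>

lemma (in comm_group) internal_direct_productI:
  assumes J: "finite J" and H: "\<And>j. j \<in> J \<Longrightarrow> subgroup (H j) G"
    and gen: "carrier G \<subseteq> generate G (\<Union>j\<in>J. H j)"
    and indep: "\<And>h j. h \<in> Pi J H \<Longrightarrow> finprod G h J = \<one> \<Longrightarrow> j \<in> J \<Longrightarrow> h j = \<one>"
  shows "internal_direct_product G J H"
  unfolding internal_direct_product_def
proof (intro conjI ballI)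
  have HG: "h \<in> J \<rightarrow> carrier G" if "h \<in> Pi J H" for h
    using H that subgroup.mem_carrier by fastforce
  show "group G" by (rule is_group)
  show "H j \<lhd> G" if "j \<in> J" for j
    using H[OF that] subgroup_imp_normal by blast
  have "(\<Union>j\<in>J. H j) \<subseteq> carrier G" using H subgroup.subset by blast
  then show "generate G (\<Union>j\<in>J. H j) = carrier G"
    using gen generate_incl by blast
  show "H j \<inter> generate G (\<Union>i\<in>J - {j}. H i) = {\<one>}" if j: "j \<in> J" for j
  proof -
    have gen': "generate G (\<Union>i\<in>J - {j}. H i) = {finprod G h (J - {j}) | h. h \<in> Pi (J - {j}) H}"
      using J H by (intro generate_UN_subgroups) auto
    have "x = \<one>" if x: "x \<in> H j" "x \<in> generate G (\<Union>i\<in>J - {j}. H i)" for x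
    proof -
      obtain h where h: "h \<in> Pi (J - {j}) H" "x = finprod G h (J - {j})"
        using x(2) gen' by auto
      \<comment> \<open>Putting \<open>inv x\<close> in position \<open>j\<close> cancels the
        product \<open>x\<close> of the remaining factors.\<close>
      let ?h = "h(j := inv x)"
      have xG: "x \<in> carrier G" using x H[OF j] subgroup.mem_carrier by metis
      have hc: "h i \<in> carrier G" if "i \<in> J" "i \<noteq> j" for i
        using h(1) H that subgroup.mem_carrier by fastforce
      have hJ: "?h \<in> Pi J H"
        using h(1) subgroup.m_inv_closed[OF H[OF j] x(1)] by (auto simp: Pi_iff)
      have "finprod G ?h J = finprod G ?h (insert j (J - {j}))"
        using j by (simp add: insert_absorb)
      also have "\<dots> = inv x \<otimes> finprod G ?h (J - {j})"
        using J hc xG by (subst finprod_insert) auto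
      also have "finprod G ?h (J - {j}) = x"
        unfolding h(2)
        by (rule finprod_cong') (use hc in auto)
      finally have "finprod G ?h J = \<one>" using xG by (simp only: l_inv)
      from indep[OF hJ this j] have "inv x = \<one>" by simp
      then show ?thesis using xG by (metis inv_inv inv_one)
    qed
    then show ?thesis
      using subgroup.one_closed[OF H[OF j]] generate.one[of G] by blast
  qed
qed

section \<open>Truncated polynomials and the filtration by powers of \<open>x\<close>\<close>

lemma (in UP_ring) coeff_monom_mult_less:
  assumes "c \<in> carrier R" "f \<in> carrier P" "i < m"
  shows "up_ring.coeff P (up_ring.monom P c m \<otimes>\<^bsub>P\<^esub> f) i = \<zero>"
  using assms by (simp, intro R.add.finprod_one_eqI) auto

text \<open>Division by the power of the variable is a shift of the coefficient function by
  \<open>m\<close>. The shift is defined on raw functions, hence the detour through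
  \<open>up R\<close> to see that it is a polynomial.\<close>

lemma (in UP_cring) monom_dvdE:
  assumes f: "f \<in> carrier P" and z: "\<And>i. i < m \<Longrightarrow> up_ring.coeff P f i = \<zero>"
  obtains g where "g \<in> carrier P" "f = up_ring.monom P \<one> m \<otimes>\<^bsub>P\<^esub> g"
proof
  define g where "g = (\<lambda>i. f (i + m))"
  have carr: "carrier P = up R" and co: "up_ring.coeff P = (\<lambda>h\<in>up R. \<lambda>i. h i)"
    unfolding P_def UP_def by simp_all
  have fu: "f \<in> up R" using f unfolding carr .
  obtain b where b: "bound \<zero> b f" using R.bound_upD[OF fu] by blast
  have "bound \<zero> b g" using b unfolding bound_def g_def by simp
  then have gu: "g \<in> up R"
    unfolding g_def using mem_upD[OF fu] by (intro mem_upI) blast+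
  show g: "g \<in> carrier P" unfolding carr by (rule gu)
  have cg: "up_ring.coeff P g i = up_ring.coeff P f (i + m)" for i
    unfolding co restrict_def using fu gu by (simp only: if_True) (simp only: g_def)
  show "f = up_ring.monom P \<one> m \<otimes>\<^bsub>P\<^esub> g"
  proof (rule up_eqI)
    fix i
    show "up_ring.coeff P f i = up_ring.coeff P (up_ring.monom P \<one> m \<otimes>\<^bsub>P\<^esub> g) i"
    proof (cases "i < m")
      case True
      then show ?thesis using z g by (simp add: coeff_monom_mult_less del: coeff_mult)
    next
      case False
      then obtain j where "i = j + m" using le_Suc_ex[of m i] by (auto simp: add.commute)
      then show ?thesis using coeff_monom_mult[OF R.one_closed g, of m j] cg f by (simp del: coeff_mult)
    qed
  qed (use f g in auto)
qed

locale trunc_poly = UP_domain +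
  fixes n :: nat
  assumes n_pos: "n \<ge> 1"
begin

abbreviation A where "A \<equiv> trunc_ring R n"

definition tp where "tp f = x_ideal R n +>\<^bsub>P\<^esub> f"

text \<open>The value \<open>cf a i\<close> is independent of the representative only for \<open>i < n\<close>.\<close>

definition cf :: "(nat \<Rightarrow> 'a) set \<Rightarrow> nat \<Rightarrow> 'a"
  where "cf a = up_ring.coeff P (SOME f. f \<in> a)"

lemma x_ideal_eq: "x_ideal R n = PIdl\<^bsub>P\<^esub> (up_ring.monom P \<one> n)"
  unfolding x_ideal_def P_def[symmetric] by (rule P.cgenideal_eq_genideal[symmetric]) simp

lemma ideal_x_ideal: "ideal (x_ideal R n) P"
  unfolding x_ideal_eq by (rule P.cgenideal_ideal) simp

text \<open>A multiple of \<open>x^n\<close> has no lower coefficients; conversely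
  \<open>monom_dvdE\<close> divides by \<open>x^n\<close>.\<close>

lemma mem_x_ideal_iff:
  "f \<in> x_ideal R n \<longleftrightarrow> f \<in> carrier P \<and> (\<forall>i<n. up_ring.coeff P f i = \<zero>)"
proof
  assume "f \<in> x_ideal R n"
  then obtain g where "g \<in> carrier P" "f = g \<otimes>\<^bsub>P\<^esub> up_ring.monom P \<one> n"
    by (auto simp: x_ideal_eq cgenideal_def)
  then have "g \<in> carrier P" "f = up_ring.monom P \<one> n \<otimes>\<^bsub>P\<^esub> g" by (auto simp: P.m_comm)
  then show "f \<in> carrier P \<and> (\<forall>i<n. up_ring.coeff P f i = \<zero>)"
    by (simp add: coeff_monom_mult_less del: coeff_mult)
next
  assume f: "f \<in> carrier P \<and> (\<forall>i<n. up_ring.coeff P f i = \<zero>)"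
  then obtain g where "g \<in> carrier P" "f = up_ring.monom P \<one> n \<otimes>\<^bsub>P\<^esub> g"
    using monom_dvdE[of f n] by metis
  then show "f \<in> x_ideal R n"
    by (auto simp: x_ideal_eq cgenideal_def P.m_comm)
qed

lemma A_eq: "A = P Quot x_ideal R n"
  by (simp add: trunc_ring_def P_def)

lemma A_cring: "cring A"
  unfolding A_eq by (rule ideal.quotient_is_cring[OF ideal_x_ideal P.cring_axioms])

sublocale A: cring A by (rule A_cring)

lemma tp_hom: "tp \<in> ring_hom P A"
  unfolding A_eq tp_def[abs_def] by (rule ideal.rcos_ring_hom[OF ideal_x_ideal])

lemma tp_closed [simp]: "f \<in> carrier P \<Longrightarrow> tp f \<in> carrier A"
  using tp_hom by (rule ring_hom_closed)

lemma tp_mult: "f \<in> carrier P \<Longrightarrow> g \<in> carrier P \<Longrightarrow> tp f \<otimes>\<^bsub>A\<^esub> tp g = tp (f \<otimes>\<^bsub>P\<^esub> g)"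
  using ring_hom_mult[OF tp_hom] by simp

lemma tp_one: "tp \<one>\<^bsub>P\<^esub> = \<one>\<^bsub>A\<^esub>"
  using ring_hom_one[OF tp_hom] .

lemma tp_pow: "f \<in> carrier P \<Longrightarrow> tp f [^]\<^bsub>A\<^esub> (m::nat) = tp (f [^]\<^bsub>P\<^esub> m)"
  by (induction m) (simp_all add: tp_one tp_mult)

lemma A_E:
  assumes "a \<in> carrier A"
  obtains f where "f \<in> carrier P" "a = tp f"
  using assms unfolding A_eq tp_def by (auto simp: FactRing_simps)

text \<open>This describes cosets by coefficients; through it, equality in the quotient becomes
  agreement of the coefficients below \<open>n\<close> (\<open>tp_eq_iff\<close>,
  \<open>A_eqI\<close>).\<close>

lemma mem_tp_iff:
  assumes "f \<in> carrier P"
  shows "g \<in> tp f \<longleftrightarrow> g \<in> carrier P \<and> (\<forall>i<n. up_ring.coeff P g i = up_ring.coeff P f i)"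
proof
  assume "g \<in> tp f"
  then obtain h where "h \<in> x_ideal R n" "g = h \<oplus>\<^bsub>P\<^esub> f"
    by (auto simp: tp_def a_r_coset_def')
  then show "g \<in> carrier P \<and> (\<forall>i<n. up_ring.coeff P g i = up_ring.coeff P f i)"
    using assms by (auto simp: mem_x_ideal_iff)
next
  assume g: "g \<in> carrier P \<and> (\<forall>i<n. up_ring.coeff P g i = up_ring.coeff P f i)"
  then have "g \<ominus>\<^bsub>P\<^esub> f \<in> x_ideal R n"
    using assms by (auto simp: mem_x_ideal_iff R.r_neg P.minus_eq)
  moreover have "g = (g \<ominus>\<^bsub>P\<^esub> f) \<oplus>\<^bsub>P\<^esub> f"
    using assms g by (simp add: P.minus_eq P.a_assoc P.l_neg)
  ultimately show "g \<in> tp f" by (auto simp: tp_def a_r_coset_def')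
qed

lemma cf_tp [simp]:
  assumes "f \<in> carrier P" "i < n"
  shows "cf (tp f) i = up_ring.coeff P f i"
proof -
  have "f \<in> tp f" using assms by (simp add: mem_tp_iff)
  then have "(SOME g. g \<in> tp f) \<in> tp f" by (rule someI[where P = "\<lambda>g. g \<in> tp f"])
  then show ?thesis using assms by (simp add: mem_tp_iff cf_def)
qed

lemma tp_eq_iff:
  assumes "f \<in> carrier P" "g \<in> carrier P"
  shows "tp f = tp g \<longleftrightarrow> (\<forall>i<n. up_ring.coeff P f i = up_ring.coeff P g i)"
proof
  assume "tp f = tp g"
  moreover have "f \<in> tp f" using assms by (simp add: mem_tp_iff)
  ultimately show "\<forall>i<n. up_ring.coeff P f i = up_ring.coeff P g i"
    using assms by (simp add: mem_tp_iff)
qed (auto simp: set_eq_iff mem_tp_iff assms)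

lemma A_eqI:
  assumes "a \<in> carrier A" "b \<in> carrier A" "\<And>i. i < n \<Longrightarrow> cf a i = cf b i"
  shows "a = b"
  using assms by (metis A_E cf_tp tp_eq_iff)

lemma cf_closed [simp]: "a \<in> carrier A \<Longrightarrow> i < n \<Longrightarrow> cf a i \<in> carrier R"
  by (erule A_E) simp

lemma cf_one: "i < n \<Longrightarrow> cf \<one>\<^bsub>A\<^esub> i = (if i = 0 then \<one> else \<zero>)"
  unfolding tp_one[symmetric] by simp

lemma cf_mult_0:
  assumes "a \<in> carrier A" "b \<in> carrier A"
  shows "cf (a \<otimes>\<^bsub>A\<^esub> b) 0 = cf a 0 \<otimes> cf b 0"
proof -
  obtain f g where "f \<in> carrier P" "a = tp f" "g \<in> carrier P" "b = tp g"
    using assms A_E by metis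
  then show ?thesis using n_pos by (simp add: tp_mult)
qed

section \<open>Products and \<open>p\<close>-th powers of elements congruent to 1 modulo a power of
  \<open>x\<close>\<close>

lemma UP_char:
  assumes "add_pow R (p::nat) \<one> = \<zero>"
  shows "add_pow P p \<one>\<^bsub>P\<^esub> = \<zero>\<^bsub>P\<^esub>"
proof -
  have "up_ring.coeff P (add_pow P m \<one>\<^bsub>P\<^esub>) i = (if i = 0 then add_pow R m \<one> else \<zero>)" for m :: nat and i
    by (induction m) auto
  then show ?thesis using assms by (intro up_eqI) auto
qed

text \<open>Normal form for representatives of elements of \<open>V j\<close> below. The cofactor
  \<open>g\<close> is kept explicit because, for \<open>j \<ge> 1\<close>, its constant term is the
  coefficient at \<open>x^j\<close>.\<close>

definition one_plus where "one_plus j g = \<one>\<^bsub>P\<^esub> \<oplus>\<^bsub>P\<^esub> up_ring.monom P \<one> j \<otimes>\<^bsub>P\<^esub> g"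

lemma one_plus_closed [simp]: "g \<in> carrier P \<Longrightarrow> one_plus j g \<in> carrier P"
  by (simp add: one_plus_def)

lemma coeff_one_plus:
  assumes "g \<in> carrier P" "j \<ge> 1"
  shows "i < j \<Longrightarrow> up_ring.coeff P (one_plus j g) i = (if i = 0 then \<one> else \<zero>)"
    and "up_ring.coeff P (one_plus j g) j = up_ring.coeff P g 0"
  using assms coeff_monom_mult[OF R.one_closed assms(1), of j 0]
  by (simp_all add: one_plus_def coeff_monom_mult_less del: coeff_mult)

text \<open>Cofactors add up to an error divisible by \<open>x^j\<close>; this is what makes leading
  coefficients additive.\<close>

lemma one_plus_mult:
  assumes g: "g \<in> carrier P" and h: "h \<in> carrier P"
  shows "one_plus j g \<otimes>\<^bsub>P\<^esub> one_plus j h =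
    one_plus j (g \<oplus>\<^bsub>P\<^esub> h \<oplus>\<^bsub>P\<^esub> up_ring.monom P \<one> j \<otimes>\<^bsub>P\<^esub> (g \<otimes>\<^bsub>P\<^esub> h))"
proof -
  have x: "up_ring.monom P \<one> j \<in> carrier P" by simp
  from x g h show ?thesis unfolding one_plus_def by algebra
qed

text \<open>Frobenius in the polynomial ring removes all cross terms, so the depth \<open>j\<close>
  is multiplied by \<open>p\<close>.\<close>

lemma one_plus_pow_prime:
  assumes g: "g \<in> carrier P" and p: "Factorial_Ring.prime (p::nat)" and char: "add_pow R p \<one> = \<zero>"
  shows "one_plus j g [^]\<^bsub>P\<^esub> p = one_plus (j * p) (g [^]\<^bsub>P\<^esub> p)"
  unfolding one_plus_def
  using g P.frobenius_add[OF p UP_char[OF char], of "\<one>\<^bsub>P\<^esub>" "up_ring.monom P \<one> j \<otimes>\<^bsub>P\<^esub> g"]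
  by (simp add: P.nat_pow_distrib monom_pow)

lemma coeff_pow_0: "g \<in> carrier P \<Longrightarrow> up_ring.coeff P (g [^]\<^bsub>P\<^esub> (m::nat)) 0 = up_ring.coeff P g 0 [^] m"
  by (induction m) auto

text \<open>The guard \<open>i < n\<close> is there because \<open>cf\<close> depends on the chosen
  representative from \<open>n\<close> on. As a consequence \<open>V j\<close> is trivial for
  \<open>j \<ge> n\<close> (\<open>V_ge_n\<close>), which ends the later inductions.\<close>

definition V :: "nat \<Rightarrow> (nat \<Rightarrow> 'a) set set"
  where "V j = {a \<in> carrier A. \<forall>i<n. i < j \<longrightarrow> cf a i = (if i = 0 then \<one> else \<zero>)}"

lemma V_closed: "a \<in> V j \<Longrightarrow> a \<in> carrier A"
  by (simp add: V_def)

lemma V_E: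
  assumes "a \<in> V j" "j \<ge> 1"
  obtains g where "g \<in> carrier P" "a = tp (one_plus j g)"
proof (cases "j < n")
  case True
  obtain f where f: "f \<in> carrier P" "a = tp f" using assms V_closed A_E by metis
  have "up_ring.coeff P (f \<ominus>\<^bsub>P\<^esub> \<one>\<^bsub>P\<^esub>) i = \<zero>" if "i < j" for i
    using assms(1) f that True by (auto simp: V_def P.minus_eq R.r_neg)
  then obtain g where g: "g \<in> carrier P" "f \<ominus>\<^bsub>P\<^esub> \<one>\<^bsub>P\<^esub> = up_ring.monom P \<one> j \<otimes>\<^bsub>P\<^esub> g"
    using monom_dvdE[of "f \<ominus>\<^bsub>P\<^esub> \<one>\<^bsub>P\<^esub>" j] f by auto
  have "f = \<one>\<^bsub>P\<^esub> \<oplus>\<^bsub>P\<^esub> (f \<ominus>\<^bsub>P\<^esub> \<one>\<^bsub>P\<^esub>)"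
    using f(1) P.one_closed by algebra
  then show ?thesis using that g f by (simp add: one_plus_def)
next
  case False
  \<comment> \<open>From degree \<open>n\<close> on only the unit is left, and the zero cofactor
    represents it.\<close>
  have "a = tp (one_plus j \<zero>\<^bsub>P\<^esub>)"
    using assms False by (intro A_eqI) (auto simp: V_def coeff_one_plus)
  then show ?thesis using that by blast
qed

lemma tp_one_plus:
  assumes "g \<in> carrier P" "j \<ge> 1"
  shows "tp (one_plus j g) \<in> V j" "j < n \<Longrightarrow> cf (tp (one_plus j g)) j = up_ring.coeff P g 0"
  using assms by (auto simp: V_def coeff_one_plus)

text \<open>By \<open>one_plus_mult\<close> the cofactor of the product is \<open>g + h\<close> plus
  a multiple of \<open>x^j\<close>, and that multiple has no constant term since
  \<open>j \<ge> 1\<close>.\<close>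

lemma V_mult:
  assumes "a \<in> V j" "b \<in> V j" "j \<ge> 1"
  shows "a \<otimes>\<^bsub>A\<^esub> b \<in> V j" "j < n \<Longrightarrow> cf (a \<otimes>\<^bsub>A\<^esub> b) j = cf a j \<oplus> cf b j"
proof -
  obtain g h where gh: "g \<in> carrier P" "a = tp (one_plus j g)" "h \<in> carrier P" "b = tp (one_plus j h)"
    using assms V_E by metis
  then have e: "a \<otimes>\<^bsub>A\<^esub> b = tp (one_plus j (g \<oplus>\<^bsub>P\<^esub> h \<oplus>\<^bsub>P\<^esub> up_ring.monom P \<one> j \<otimes>\<^bsub>P\<^esub> (g \<otimes>\<^bsub>P\<^esub> h)))"
    by (simp add: tp_mult one_plus_mult)
  then show "a \<otimes>\<^bsub>A\<^esub> b \<in> V j" using gh assms tp_one_plus by simp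
  have "up_ring.coeff P (up_ring.monom P \<one> j \<otimes>\<^bsub>P\<^esub> (g \<otimes>\<^bsub>P\<^esub> h)) 0 = \<zero>"
    using gh assms by (intro coeff_monom_mult_less) auto
  then show "j < n \<Longrightarrow> cf (a \<otimes>\<^bsub>A\<^esub> b) j = cf a j \<oplus> cf b j"
    unfolding e using gh assms by (simp add: coeff_one_plus(2) del: coeff_mult)
qed

lemma V_one: "\<one>\<^bsub>A\<^esub> \<in> V j"
  by (simp add: V_def cf_one)

lemma V_antimono: "i \<le> j \<Longrightarrow> V j \<subseteq> V i"
  by (auto simp: V_def)

lemma V_Suc_iff: "j \<ge> 1 \<Longrightarrow> j < n \<Longrightarrow> a \<in> V (Suc j) \<longleftrightarrow> a \<in> V j \<and> cf a j = \<zero>"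
  by (auto simp: V_def less_Suc_eq)

lemma V_ge_n: "n \<le> j \<Longrightarrow> V j = {\<one>\<^bsub>A\<^esub>}"
  using V_one A_eqI[OF _ A.one_closed] by (auto simp: V_def cf_one)

lemma V_pow:
  assumes "a \<in> V j" "j \<ge> 1"
  shows "a [^]\<^bsub>A\<^esub> (m::nat) \<in> V j" "j < n \<Longrightarrow> cf (a [^]\<^bsub>A\<^esub> m) j = add_pow R m (cf a j)"
  by (induction m) (use assms V_mult V_one cf_one V_closed in auto)

text \<open>By \<open>one_plus_pow_prime\<close> the new cofactor is \<open>g^p\<close>, and taking
  constant terms commutes with powers.\<close>

lemma V_pow_prime:
  assumes "a \<in> V j" "j \<ge> 1" and p: "Factorial_Ring.prime (p::nat)" and char: "add_pow R p \<one> = \<zero>"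
  shows "a [^]\<^bsub>A\<^esub> p \<in> V (j * p)"
    "j * p < n \<Longrightarrow> cf (a [^]\<^bsub>A\<^esub> p) (j * p) = cf a j [^] p"
proof -
  obtain g where g: "g \<in> carrier P" "a = tp (one_plus j g)" using assms V_E by metis
  then have e: "a [^]\<^bsub>A\<^esub> p = tp (one_plus (j * p) (g [^]\<^bsub>P\<^esub> p))"
    using one_plus_pow_prime[OF g(1) p char] by (simp add: tp_pow)
  have jp: "j * p \<ge> 1" using assms prime_gt_0_nat[OF p] by simp
  show "a [^]\<^bsub>A\<^esub> p \<in> V (j * p)" using e tp_one_plus(1)[OF _ jp] g by simp
  assume l: "j * p < n"
  moreover have "j < n" using l prime_gt_0_nat[OF p]
    by (metis le_less_trans mult.right_neutral mult_le_mono2 Suc_leI One_nat_def)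
  ultimately show "cf (a [^]\<^bsub>A\<^esub> p) (j * p) = cf a j [^] p"
    using e tp_one_plus(2)[OF _ jp] g tp_one_plus(2)[OF g(1) assms(2)] by (simp add: coeff_pow_0)
qed

text \<open>Iterates \<open>V_pow_prime\<close>. Both claims share one induction because the
  coefficient claim for \<open>Suc r\<close> needs membership at \<open>r\<close>.\<close>

lemma V_pow_prime_power:
  assumes "a \<in> V j" "j \<ge> 1" and p: "Factorial_Ring.prime (p::nat)" and char: "add_pow R p \<one> = \<zero>"
  shows "a [^]\<^bsub>A\<^esub> (p ^ r) \<in> V (j * p ^ r)"
    "j * p ^ r < n \<Longrightarrow> cf (a [^]\<^bsub>A\<^esub> (p ^ r)) (j * p ^ r) = cf a j [^] (p ^ r)"
proof (induction r)
  case 0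
  {
    case 1
    then show ?case using assms V_closed by simp
  next
    case 2
    then show ?case using assms V_closed by simp
  }
next
  case (Suc r)
  have e: "a [^]\<^bsub>A\<^esub> (p ^ Suc r) = (a [^]\<^bsub>A\<^esub> (p ^ r)) [^]\<^bsub>A\<^esub> p" "j * p ^ Suc r = j * p ^ r * p"
    using V_closed[OF assms(1)] by (simp_all add: A.nat_pow_pow mult_ac)
  have jr: "j * p ^ r \<ge> 1" using assms prime_gt_0_nat[OF p] by simp
  note * = V_pow_prime[OF Suc(1) jr p char]
  {
    case 1
    then show ?case unfolding e by (rule *(1))
  next
    case 2
    \<comment> \<open>The coefficient hypothesis is guarded by \<open>< n\<close>; since factors
      \<open>p\<close> only raise the degree, the earlier degrees \<open>j * p ^ r\<close> and
      \<open>j\<close> are below \<open>n\<close> too.\<close>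
    have "j * p ^ r \<le> j * p ^ r * p" using prime_gt_0_nat[OF p] by simp
    then have l: "j * p ^ r < n" using 2 unfolding e by linarith
    moreover have "j \<le> j * p ^ r" using prime_gt_0_nat[OF p] by simp
    ultimately have "j < n" by linarith
    then show ?case using * 2 Suc(2)[OF l] cf_closed[OF V_closed[OF assms(1)]]
      unfolding e by (simp add: R.nat_pow_pow mult.commute)
  }
qed

end

section \<open>The unitary group\<close>

text \<open>Conjugation enters here only as an involutive ring homomorphism. Both properties are
  proved for the quadratic extension in \<open>quad_ext\<close> and supplied in
  \<open>unitary_decomp\<close>.\<close>

locale trunc_unitary = trunc_poly +
  fixes k :: "'a set" and \<Delta> :: 'a
  assumes conj_hom: "quad_conj R k \<Delta> \<in> ring_hom R R"
    and conj_conj: "x \<in> carrier R \<Longrightarrow> quad_conj R k \<Delta> (quad_conj R k \<Delta> x) = x"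
begin

abbreviation \<sigma> where "\<sigma> \<equiv> quad_conj R k \<Delta>"
abbreviation U where "U \<equiv> unitary_group R k \<Delta> n"
abbreviation star where "star \<equiv> trunc_star R k \<Delta>"

definition sg :: "nat \<Rightarrow> 'a \<Rightarrow> 'a" where "sg i c = (if even i then c else \<ominus> c)"

lemma sg_closed [simp]: "c \<in> carrier R \<Longrightarrow> sg i c \<in> carrier R"
  by (simp add: sg_def)

sublocale S: ring_hom_cring R R \<sigma>
  by unfold_locales (rule conj_hom)

lemma coeff_poly_star:
  assumes f: "f \<in> carrier P"
  shows "poly_star R k \<Delta> f \<in> carrier P"
    and "up_ring.coeff P (poly_star R k \<Delta> f) i = sg i (\<sigma> (up_ring.coeff P f i))"
proof -
  have carr: "carrier P = up R" and co: "up_ring.coeff P = (\<lambda>h\<in>up R. \<lambda>i. h i)"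
    unfolding P_def UP_def by simp_all
  have fu: "f \<in> up R" using f unfolding carr .
  have e: "poly_star R k \<Delta> f = (\<lambda>i. sg i (\<sigma> (f i)))"
    unfolding poly_star_def P_def[symmetric] co restrict_def sg_def using fu by auto
  obtain b where b: "bound \<zero> b f" using R.bound_upD[OF fu] by blast
  have "bound \<zero> b (\<lambda>i. sg i (\<sigma> (f i)))"
    using b unfolding bound_def by (simp add: sg_def)
  then have gu: "(\<lambda>i. sg i (\<sigma> (f i))) \<in> up R"
    using mem_upD[OF fu] by (intro mem_upI) (simp, blast)
  show "poly_star R k \<Delta> f \<in> carrier P" unfolding carr e by (rule gu)
  show "up_ring.coeff P (poly_star R k \<Delta> f) i = sg i (\<sigma> (up_ring.coeff P f i))"
    unfolding co restrict_def e using fu gu by simp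
qed

lemma sg_sg: "c \<in> carrier R \<Longrightarrow> sg i (\<sigma> (sg i (\<sigma> c))) = c"
  by (simp add: sg_def conj_conj)

lemma poly_star_star:
  assumes "f \<in> carrier P"
  shows "poly_star R k \<Delta> (poly_star R k \<Delta> f) = f"
  using assms by (intro up_eqI) (simp_all add: coeff_poly_star sg_sg)

text \<open>The involution on polynomials respects congruence modulo \<open>x^n\<close>, which gives
  one inclusion; the other follows because it is its own inverse.\<close>

lemma star_tp:
  assumes f: "f \<in> carrier P"
  shows "star (tp f) = tp (poly_star R k \<Delta> f)"
proof -
  have imp: "poly_star R k \<Delta> g \<in> tp (poly_star R k \<Delta> h)" if "g \<in> tp h" "h \<in> carrier P" for g h
    using that by (simp add: mem_tp_iff coeff_poly_star)
  show ?thesis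
  proof
    show "star (tp f) \<subseteq> tp (poly_star R k \<Delta> f)"
      unfolding trunc_star_def using imp f by auto
    show "tp (poly_star R k \<Delta> f) \<subseteq> star (tp f)"
    proof
      fix g assume g: "g \<in> tp (poly_star R k \<Delta> f)"
      then have gP: "g \<in> carrier P" using f by (simp add: mem_tp_iff coeff_poly_star)
      have "poly_star R k \<Delta> g \<in> tp f"
        using imp[OF g] f by (simp add: coeff_poly_star poly_star_star)
      then show "g \<in> star (tp f)"
        unfolding trunc_star_def using poly_star_star[OF gP] by (metis imageI)
    qed
  qed
qed

lemma star_closed [simp]: "a \<in> carrier A \<Longrightarrow> star a \<in> carrier A"
  by (erule A_E) (simp add: star_tp coeff_poly_star)

lemma cf_star:
  assumes "a \<in> carrier A" "i < n"
  shows "cf (star a) i = sg i (\<sigma> (cf a i))"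
  using assms(1) by (rule A_E) (use assms in \<open>simp add: star_tp coeff_poly_star\<close>)

lemma star_star: "a \<in> carrier A \<Longrightarrow> star (star a) = a"
  by (erule A_E) (simp add: star_tp coeff_poly_star poly_star_star)

text \<open>Conjugation is multiplicative on coefficients, and the sign of degree \<open>i\<close>
  is the product of the signs of degrees \<open>j\<close> and \<open>i - j\<close>, so each term of
  the convolution is respected.\<close>

lemma poly_star_mult:
  assumes f: "f \<in> carrier P" and g: "g \<in> carrier P"
  shows "poly_star R k \<Delta> (f \<otimes>\<^bsub>P\<^esub> g) = poly_star R k \<Delta> f \<otimes>\<^bsub>P\<^esub> poly_star R k \<Delta> g"
proof (rule up_eqI)
  fix i
  have neg: "sg i (\<Oplus>j\<in>{..i}. h j) = (\<Oplus>j\<in>{..i}. sg i (h j))" if "h \<in> {..i} \<rightarrow> carrier R" for h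
  proof (cases "even i")
    case False
    have "(\<Oplus>j\<in>{..i}. \<ominus> h j) = (\<Oplus>j\<in>{..i}. \<ominus> \<one> \<otimes> h j)"
      using that by (intro R.finsum_cong') (auto simp: R.l_minus Pi_iff)
    also have "\<dots> = \<ominus> \<one> \<otimes> (\<Oplus>j\<in>{..i}. h j)"
      using that by (intro R.finsum_rdistr[symmetric]) auto
    finally show ?thesis using False that by (simp add: sg_def R.l_minus)
  qed (use that in \<open>simp add: sg_def\<close>)
  have sgm: "sg i (a \<otimes> b) = sg j a \<otimes> sg (i - j) b"
    if "j \<le> i" "a \<in> carrier R" "b \<in> carrier R" for j a b
    using that by (auto simp: sg_def R.l_minus R.r_minus)
  have "up_ring.coeff P (poly_star R k \<Delta> (f \<otimes>\<^bsub>P\<^esub> g)) i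
      = sg i (\<Oplus>j\<in>{..i}. \<sigma> (up_ring.coeff P f j \<otimes> up_ring.coeff P g (i - j)))"
    using f g by (simp add: coeff_poly_star S.hom_finsum Pi_iff o_def)
  also have "\<dots> = (\<Oplus>j\<in>{..i}. sg i (\<sigma> (up_ring.coeff P f j) \<otimes> \<sigma> (up_ring.coeff P g (i - j))))"
    using f g by (subst neg) auto
  also have "\<dots> = (\<Oplus>j\<in>{..i}. sg j (\<sigma> (up_ring.coeff P f j)) \<otimes> sg (i - j) (\<sigma> (up_ring.coeff P g (i - j))))"
    using f g by (intro R.finsum_cong') (auto simp: sgm)
  also have "\<dots> = up_ring.coeff P (poly_star R k \<Delta> f \<otimes>\<^bsub>P\<^esub> poly_star R k \<Delta> g) i"
    using f g by (simp add: coeff_poly_star)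
  finally show "up_ring.coeff P (poly_star R k \<Delta> (f \<otimes>\<^bsub>P\<^esub> g)) i
      = up_ring.coeff P (poly_star R k \<Delta> f \<otimes>\<^bsub>P\<^esub> poly_star R k \<Delta> g) i" .
qed (use f g in \<open>auto simp: coeff_poly_star\<close>)

lemma star_mult:
  assumes "a \<in> carrier A" "b \<in> carrier A"
  shows "star (a \<otimes>\<^bsub>A\<^esub> b) = star a \<otimes>\<^bsub>A\<^esub> star b"
proof -
  obtain f g where "f \<in> carrier P" "a = tp f" "g \<in> carrier P" "b = tp g"
    using assms A_E by metis
  then show ?thesis by (simp add: tp_mult star_tp poly_star_mult coeff_poly_star)
qed

lemma star_one: "star \<one>\<^bsub>A\<^esub> = \<one>\<^bsub>A\<^esub>"
  by (rule A_eqI) (auto simp: cf_star cf_one sg_def)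

lemma U_simps [simp]: "monoid.mult U = monoid.mult A" "one U = one A"
  by (simp_all add: unitary_group_def)

lemma mem_U_iff: "a \<in> carrier U \<longleftrightarrow> a \<in> carrier A \<and> a \<otimes>\<^bsub>A\<^esub> star a = \<one>\<^bsub>A\<^esub>"
  by (auto simp: unitary_group_def)

lemma U_closed: "a \<in> carrier U \<Longrightarrow> a \<in> carrier A"
  by (simp add: mem_U_iff)

lemma star_U: "a \<in> carrier U \<Longrightarrow> star a \<in> carrier U"
  by (simp add: mem_U_iff star_star A.m_comm)

lemma U_comm_group: "comm_group U"
proof (rule comm_groupI; simp)
  fix a b assume "a \<in> carrier U" "b \<in> carrier U"
  then have ab: "a \<in> carrier A" "a \<otimes>\<^bsub>A\<^esub> star a = \<one>\<^bsub>A\<^esub>" "b \<in> carrier A" "b \<otimes>\<^bsub>A\<^esub> star b = \<one>\<^bsub>A\<^esub>"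
    "star a \<in> carrier A" "star b \<in> carrier A"
    by (auto simp: mem_U_iff)
  have "a \<otimes>\<^bsub>A\<^esub> b \<otimes>\<^bsub>A\<^esub> (star a \<otimes>\<^bsub>A\<^esub> star b) = (a \<otimes>\<^bsub>A\<^esub> star a) \<otimes>\<^bsub>A\<^esub> (b \<otimes>\<^bsub>A\<^esub> star b)"
    using ab(1,3,5,6) by (simp add: A.m_ac)
  then show "a \<otimes>\<^bsub>A\<^esub> b \<in> carrier U"
    using ab by (simp add: mem_U_iff star_mult)
next
  fix a assume "a \<in> carrier U"
  then show "\<exists>b\<in>carrier U. b \<otimes>\<^bsub>A\<^esub> a = \<one>\<^bsub>A\<^esub>"
    using star_U by (intro bexI[of _ "star a"]) (auto simp: mem_U_iff A.m_comm)
qed (auto simp: mem_U_iff star_one A.m_ac)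

text \<open>The rewrites state the group laws with the product and unit of \<open>A\<close>, so that
  facts about \<open>V\<close> combine with them directly.\<close>

sublocale U: comm_group U
  rewrites "monoid.mult U = monoid.mult A" and "one U = one A"
  by (rule U_comm_group) simp_all

lemma U_inv: "a \<in> carrier U \<Longrightarrow> inv\<^bsub>U\<^esub> a = star a"
  using star_U by (intro U.comm_inv_char) (auto simp: mem_U_iff)

lemma U_pow: "a [^]\<^bsub>U\<^esub> (m::nat) = a [^]\<^bsub>A\<^esub> m"
  by (simp add: nat_pow_def)

definition W :: "nat \<Rightarrow> (nat \<Rightarrow> 'a) set set" where "W j = V j \<inter> carrier U"

lemma star_V: "a \<in> V j \<Longrightarrow> star a \<in> V j"
  by (auto simp: V_def cf_star sg_def)

lemma W_subgroup: "j \<ge> 1 \<Longrightarrow> subgroup (W j) U"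
  by (rule U.subgroupI) (use V_one U.one_closed in \<open>auto simp: W_def V_mult U_inv star_U star_V\<close>)

text \<open>The homomorphism property of the leading coefficient, extended from two factors to
  finite products. Adding a factor by \<open>V_mult\<close> needs the partial product in
  \<open>W j\<close>, hence a joint induction.\<close>

lemma W_finprod:
  assumes "j \<ge> 1" "h \<in> J \<rightarrow> W j" "finite J"
  shows "finprod U h J \<in> W j" "j < n \<Longrightarrow> cf (finprod U h J) j = (\<Oplus>x\<in>J. cf (h x) j)"
proof -
  have "finprod U h J \<in> W j \<and> (j < n \<longrightarrow> cf (finprod U h J) j = (\<Oplus>x\<in>J. cf (h x) j))"
    using assms(3,2)
  proof (induction J rule: finite_induct)
    case empty
    then show ?case using assms(1) V_one U.one_closed by (auto simp: W_def cf_one)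
  next
    case (insert x J)
    have hU: "h \<in> insert x J \<rightarrow> carrier U" "h \<in> insert x J \<rightarrow> V j"
      using insert.prems by (auto simp: W_def)
    have IH: "finprod U h J \<in> W j" "j < n \<Longrightarrow> cf (finprod U h J) j = (\<Oplus>x\<in>J. cf (h x) j)"
      using insert by auto
    have e: "finprod U h (insert x J) = h x \<otimes>\<^bsub>A\<^esub> finprod U h J"
      using insert hU by (intro U.finprod_insert) auto
    have "finprod U h (insert x J) \<in> W j"
      unfolding e using insert.prems IH(1) subgroup.m_closed[OF W_subgroup[OF assms(1)]] by auto
    moreover have "cf (finprod U h (insert x J)) j = (\<Oplus>x\<in>insert x J. cf (h x) j)" if "j < n"
    proof -
      have "cf (finprod U h (insert x J)) j = cf (h x) j \<oplus> cf (finprod U h J) j"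
        unfolding e using insert.prems IH(1) assms(1) that by (intro V_mult(2)) (auto simp: W_def)
      also have "\<dots> = (\<Oplus>x\<in>insert x J. cf (h x) j)"
        using insert hU that IH(2) V_closed by (subst R.finsum_insert) (auto simp: Pi_iff)
      finally show ?thesis .
    qed
    ultimately show ?case by blast
  qed
  then show "finprod U h J \<in> W j" "j < n \<Longrightarrow> cf (finprod U h J) j = (\<Oplus>x\<in>J. cf (h x) j)" by auto
qed

lemma W_inv:
  assumes a: "a \<in> W j" and j: "j \<ge> 1" "j < n"
  shows "cf (inv\<^bsub>U\<^esub> a) j = \<ominus> cf a j"
proof -
  have aU: "a \<in> carrier U" "inv\<^bsub>U\<^esub> a \<in> W j" "a \<in> carrier A"
    using a subgroup.m_inv_closed[OF W_subgroup[OF j(1)] a] U_closed by (auto simp: W_def)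
  have "cf (a \<otimes>\<^bsub>A\<^esub> inv\<^bsub>U\<^esub> a) j = cf a j \<oplus> cf (inv\<^bsub>U\<^esub> a) j"
    using a aU j by (intro V_mult(2)) (auto simp: W_def)
  moreover have "a \<otimes>\<^bsub>A\<^esub> inv\<^bsub>U\<^esub> a = \<one>\<^bsub>A\<^esub>" using aU by simp
  moreover have "inv\<^bsub>U\<^esub> a \<in> carrier A" using aU U_closed by (simp add: W_def)
  ultimately show ?thesis
    using aU j by (metis R.minus_equality R.a_comm cf_closed cf_one not_one_le_zero)
qed

text \<open>The inverse of a unitary element is its image under \<open>star\<close>. Comparing both
  expressions for the coefficient at \<open>x^j\<close> shows that conjugation fixes it for odd
  \<open>j\<close> and negates it for even \<open>j\<close>.\<close>

lemma W_lead:
  assumes a: "a \<in> W j" and j: "j \<ge> 1" "j < n"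
  shows "sg j (\<sigma> (cf a j)) = \<ominus> cf a j"
  using W_inv[OF assms] a j by (simp add: U_inv cf_star W_def U_closed)

section \<open>Constants of norm one and the splitting of the unitary group\<close>

definition const where "const c = tp (up_ring.monom P c 0)"

lemma const_closed: "c \<in> carrier R \<Longrightarrow> const c \<in> carrier A"
  by (simp add: const_def)

lemma cf_const: "c \<in> carrier R \<Longrightarrow> i < n \<Longrightarrow> cf (const c) i = (if i = 0 then c else \<zero>)"
  by (simp add: const_def)

lemma const_mult:
  "c \<in> carrier R \<Longrightarrow> d \<in> carrier R \<Longrightarrow> const c \<otimes>\<^bsub>A\<^esub> const d = const (c \<otimes> d)"
  using monom_mult[of c d 0 0] by (simp add: const_def tp_mult)

lemma const_one: "const \<one> = \<one>\<^bsub>A\<^esub>"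
  by (simp add: const_def tp_one)

lemma const_pow: "c \<in> carrier R \<Longrightarrow> const c [^]\<^bsub>A\<^esub> (m::nat) = const (c [^] m)"
  by (induction m) (simp_all add: const_one const_mult)

lemma const_eq_one_iff: "c \<in> carrier R \<Longrightarrow> const c = \<one>\<^bsub>A\<^esub> \<longleftrightarrow> c = \<one>"
  using n_pos cf_const[of c 0] cf_one[of 0] const_one by force

lemma star_const: "c \<in> carrier R \<Longrightarrow> star (const c) = const (\<sigma> c)"
  by (rule A_eqI) (auto simp: const_closed cf_star cf_const sg_def)

lemma const_in_U: "c \<in> carrier R \<Longrightarrow> const c \<in> carrier U \<longleftrightarrow> c \<otimes> \<sigma> c = \<one>"
  by (simp add: mem_U_iff const_closed star_const const_mult const_eq_one_iff)

text \<open>Taking constant terms is multiplicative, so the constant term has norm one and, as a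
  constant, is itself unitary; dividing by it leaves constant term 1.\<close>

lemma U_decomp:
  assumes a: "a \<in> carrier U"
  shows "cf a 0 \<otimes> \<sigma> (cf a 0) = \<one>" "inv\<^bsub>U\<^esub> (const (cf a 0)) \<otimes>\<^bsub>A\<^esub> a \<in> W 1"
proof -
  have aA: "a \<in> carrier A" "a \<otimes>\<^bsub>A\<^esub> star a = \<one>\<^bsub>A\<^esub>" "cf a 0 \<in> carrier R"
    using a n_pos by (auto simp: mem_U_iff)
  have "cf (a \<otimes>\<^bsub>A\<^esub> star a) 0 = cf a 0 \<otimes> cf (star a) 0"
    using aA by (intro cf_mult_0) auto
  then show 1: "cf a 0 \<otimes> \<sigma> (cf a 0) = \<one>"
    using aA n_pos by (simp add: cf_star cf_one sg_def)
  then have c: "const (cf a 0) \<in> carrier U" using aA by (simp add: const_in_U)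
  have "cf (inv\<^bsub>U\<^esub> (const (cf a 0)) \<otimes>\<^bsub>A\<^esub> a) 0 = \<sigma> (cf a 0) \<otimes> cf a 0"
    using aA c n_pos by (simp add: U_inv star_const cf_mult_0 const_closed cf_const)
  then have "cf (inv\<^bsub>U\<^esub> (const (cf a 0)) \<otimes>\<^bsub>A\<^esub> a) 0 = \<one>"
    using 1 aA by (simp add: R.m_comm)
  then show "inv\<^bsub>U\<^esub> (const (cf a 0)) \<otimes>\<^bsub>A\<^esub> a \<in> W 1"
    using a c U.m_closed U_closed by (auto simp: W_def V_def)
qed

text \<open>As \<open>n \<ge> 1\<close>, one representative has constant term 1 exactly when all do;
  thus the group in the definition of \<open>H_subgroup\<close> is the first filtration
  step.\<close>

lemma unitary_group0_eq: "unitary_group0 R k \<Delta> n = U\<lparr>carrier := W 1\<rparr>"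
proof -
  have "(\<exists>f\<in>b. up_ring.coeff P f 0 = \<one>) \<longleftrightarrow> b \<in> W 1" if b: "b \<in> carrier U" for b
  proof -
    obtain f where f: "f \<in> carrier P" "b = tp f" using b U_closed A_E by metis
    have "(\<exists>g\<in>b. up_ring.coeff P g 0 = \<one>) \<longleftrightarrow> up_ring.coeff P f 0 = \<one>"
      using f n_pos by (metis mem_tp_iff less_le_trans less_one)
    then show ?thesis using b f n_pos by (auto simp: W_def V_def)
  qed
  then have "{b \<in> carrier U. \<exists>f\<in>b. up_ring.coeff P f 0 = \<one>} = W 1"
    by (auto simp: W_def)
  then show ?thesis by (simp add: unitary_group0_def P_def[symmetric])
qed

text \<open>Generation inside a subgroup gives the same set as generation in \<open>U\<close>, so
  the rest of the proof can stay in \<open>U\<close>.\<close>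

lemma generate_unitary_group0:
  "z \<in> W 1 \<Longrightarrow> generate (unitary_group0 R k \<Delta> n) {z} = generate U {z}"
  unfolding unitary_group0_eq by (rule U.generate_consistent) (auto simp: W_subgroup)

end

section \<open>The quadratic extension\<close>

context cring
begin

lemma add_pow_mult: "add_pow R (m * l :: nat) \<one> = add_pow R m \<one> \<otimes> add_pow R l \<one>"
proof -
  have "add_pow R (m * l) \<one> = add_pow R m (add_pow R l \<one>)"
    by (simp add: add.nat_pow_pow mult.commute)
  then show ?thesis using add_pow_ldistr[of \<one> "add_pow R l \<one>" m] by simp
qed

lemma add_pow_eq_mult: "x \<in> carrier R \<Longrightarrow> add_pow R (m::nat) x = add_pow R m \<one> \<otimes> x"
  using add_pow_ldistr[of \<one> x m] by simp

lemma frobenius_pow_add_pow: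
  assumes p: "Factorial_Ring.prime (p::nat)" and char: "add_pow R p \<one> = \<zero>"
    and x: "x \<in> carrier R"
  shows "(add_pow R (m::nat) x) [^] (p ^ r) = add_pow R m (x [^] (p ^ r))"
proof (induction m)
  case 0
  then show ?case using p by (simp add: nat_pow_zero prime_gt_0_nat)
next
  case (Suc m)
  then show ?case using x frobenius_pow_add[OF p char] by simp
qed

end

lemma (in domain) pow_nonzero:
  "x \<in> carrier R \<Longrightarrow> x \<noteq> \<zero> \<Longrightarrow> x [^] (m::nat) \<noteq> \<zero>"
  by (induction m) (auto simp: integral_iff)

text \<open>By additivity the difference has power \<zero>, and a field has no nilpotent elements
  besides \<zero>.\<close>

lemma (in field) frobenius_pow_inj:
  assumes p: "Factorial_Ring.prime (p::nat)" and char: "add_pow R p \<one> = \<zero>"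
    and xy: "x \<in> carrier R" "y \<in> carrier R" and eq: "x [^] (p ^ r) = y [^] (p ^ r)"
  shows "x = y"
proof -
  have "x = (x \<ominus> y) \<oplus> y" using xy by algebra
  then have "x [^] (p ^ r) = (x \<ominus> y) [^] (p ^ r) \<oplus> y [^] (p ^ r)"
    using frobenius_pow_add[OF p char, of "x \<ominus> y" y r] xy by simp
  then have "y [^] (p ^ r) = (x \<ominus> y) [^] (p ^ r) \<oplus> y [^] (p ^ r)" using eq by simp
  then have "(x \<ominus> y) [^] (p ^ r) = \<zero>"
    using xy by (metis add.l_cancel_one' add.m_comm minus_closed nat_pow_closed)
  then have "x \<ominus> y = \<zero>" using xy pow_nonzero[of "x \<ominus> y"] by auto
  then show ?thesis using xy by simp
qed

text \<open>Translates the list combinations behind \<open>Span\<close> and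
  \<open>independent\<close> into indexed sums.\<close>

lemma (in ring) combine_map:
  assumes "distinct ls" "\<And>l. l \<in> set ls \<Longrightarrow> f l \<in> carrier R" "\<And>l. l \<in> set ls \<Longrightarrow> e l \<in> carrier R"
  shows "combine (map f ls) (map e ls) = (\<Oplus>l\<in>set ls. f l \<otimes> e l)"
  using assms
proof (induction ls)
  case (Cons a ls)
  then show ?case by (subst list.set(2), subst finsum_insert) auto
qed auto

text \<open>\<open>generate_field R {}\<close> is the prime field, so \<open>indep\<close> and
  \<open>span\<close> express that \<open>e 1\<close>, ..., \<open>e t\<close> is a basis of
  \<open>k\<close> over it.\<close>

locale quad_ext = field +
  fixes k :: "'a set" and \<Delta> :: 'a and p t q :: nat and e :: "nat \<Rightarrow> 'a"
  assumes sub: "subfield k R"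
    and p: "Factorial_Ring.prime p" and odd_p: "odd p" and q: "q = p ^ t"
    and fin_k: "finite k" and card_k: "card k = q"
    and dim: "dimension 2 k (carrier R)"
    and \<Delta>: "\<Delta> \<in> carrier R" and gen: "generate_field R (insert \<Delta> k) = carrier R"
    and \<Delta>2: "\<Delta> [^] (2::nat) \<in> k"
    and indep: "independent (generate_field R {}) (map e [1..<Suc t])"
    and span: "Span (generate_field R {}) (map e [1..<Suc t]) = k"
begin

lemmas sub_ring = subfieldE(1)[OF sub]
lemmas k_simps [simp] = subringE(2,3,5-7)[OF sub_ring]

lemma k_sub [simp]: "x \<in> k \<Longrightarrow> x \<in> carrier R"
  using subringE(1)[OF sub_ring] by blast

lemma k_minus [simp]: "x \<in> k \<Longrightarrow> y \<in> k \<Longrightarrow> x \<ominus> y \<in> k"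
  by (simp add: minus_eq)

lemma k_pow [simp]: "x \<in> k \<Longrightarrow> x [^] (m::nat) \<in> k"
  by (induction m) auto

lemma k_inv: "x \<in> k \<Longrightarrow> x \<noteq> \<zero> \<Longrightarrow> inv x \<in> k"
  using subfield_m_inv[OF sub] by simp

lemma k_field: "field (R\<lparr>carrier := k\<rparr>)"
  using subfield_iff(2)[OF sub] .

text \<open>The additive group of \<open>k\<close> has order \<open>p ^ t\<close>, so
  \<open>p ^ t\<close> times \<one> vanishes; in the absence of zero divisors the factors
  \<open>p\<close> can be split off one by one.\<close>

lemma char: "add_pow R p \<one> = \<zero>"
proof -
  interpret k: field "R\<lparr>carrier := k\<rparr>" by (rule k_field)
  have "pow (add_monoid (R\<lparr>carrier := k\<rparr>)) \<one> (order (add_monoid (R\<lparr>carrier := k\<rparr>))) = \<zero>"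
    using k.add.pow_order_eq_1[of \<one>] by (simp add: add_pow_def)
  then have "add_pow R (p ^ t) \<one> = \<zero>"
    using card_k q by (simp add: order_def add_pow_def nat_pow_def)
  moreover have "add_pow R p \<one> = \<zero>" if "add_pow R (p ^ s) \<one> = \<zero>" for s
    using that
  proof (induction s)
    case (Suc s)
    then have "add_pow R p \<one> \<otimes> add_pow R (p ^ s) \<one> = \<zero>" by (simp add: add_pow_mult)
    then show ?case using Suc.IH integral by auto
  qed simp
  ultimately show ?thesis by blast
qed

lemma char_dvd: "p dvd m \<Longrightarrow> add_pow R m \<one> = \<zero>"
  using add_pow_eq_zero_of_dvd[OF char] by simp

text \<open>If \<open>p\<close> does not divide \<open>m\<close>, Bezout provides an inverse of
  \<open>m\<close> modulo \<open>p\<close>, so \<open>m\<close> times \<one> is invertible.\<close>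

lemma char_iff: "add_pow R (m::nat) \<one> = \<zero> \<longleftrightarrow> p dvd m"
proof
  show "p dvd m" if m: "add_pow R m \<one> = \<zero>"
  proof (rule ccontr)
    assume "\<not> p dvd m"
    then have "coprime m p" using p by (metis coprime_commute prime_imp_coprime)
    then obtain u v where "m * u = p * v + 1"
      using bezout_nat[of m p] \<open>\<not> p dvd m\<close> by (metis coprime_iff_gcd_eq_1 dvd_0_right)
    then have "add_pow R (m * u) \<one> = \<one>" using char_dvd[of "p * v"] by simp
    then show False using m by (simp add: add_pow_mult)
  qed
qed (rule char_dvd)

lemma two: "\<one> \<oplus> \<one> \<noteq> \<zero>"
proof
  assume 2: "\<one> \<oplus> \<one> = \<zero>"
  obtain m where m: "p = Suc (2 * m)" using odd_p by (auto elim: oddE)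
  have "add_pow R (2::nat) \<one> = \<zero>" using 2 by (simp add: numeral_2_eq_2)
  then have "add_pow R (2 * m) \<one> = \<zero>" by (simp add: add_pow_mult)
  then have "add_pow R p \<one> = \<one>" unfolding m by simp
  then show False using char by simp
qed

lemma double_zero: "x \<in> carrier R \<Longrightarrow> x \<oplus> x = \<zero> \<Longrightarrow> x = \<zero>"
proof -
  assume x: "x \<in> carrier R" "x \<oplus> x = \<zero>"
  then have "(\<one> \<oplus> \<one>) \<otimes> x = \<zero>" by (simp add: l_distr)
  then show "x = \<zero>" using two x integral by fastforce
qed

text \<open>Otherwise \<open>k\<close> would be the whole field and have both dimension 1 and
  dimension 2 over itself.\<close>

lemma \<Delta>_notin: "\<Delta> \<notin> k"
proof
  assume "\<Delta> \<in> k"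
  then have "generate_field R (insert \<Delta> k) \<subseteq> k"
    by (intro generate_field_min_subfield1) (auto simp: sub)
  then have "carrier R = k" using gen by auto
  then have "dimension 2 k k" using dim by simp
  then show False using dimension_one[OF sub] dimension_is_inj[OF sub] by fastforce
qed

lemma \<Delta>_nz: "\<Delta> \<noteq> \<zero>"
  using \<Delta>_notin by auto

text \<open>\<one> and \<Delta> are independent over \<open>k\<close>, hence a basis by dimension
  2.\<close>

lemma rep:
  assumes "z \<in> carrier R"
  obtains a b where "a \<in> k" "b \<in> k" "z = a \<oplus> b \<otimes> \<Delta>"
proof -
  have "k = Span k [\<one>]"
    using line_extension_mem_iff[of _ k \<one> "{\<zero>}"] by auto
  then have "\<Delta> \<notin> Span k [\<one>]" using \<Delta>_notin by simp
  moreover have "independent k [\<one>]"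
    by (rule li_Cons) auto
  ultimately have "independent k [\<Delta>, \<one>]" using \<Delta> by (intro li_Cons) auto
  then have "Span k [\<Delta>, \<one>] = carrier R"
    using independent_length_eq_dimension[OF sub dim, of "[\<Delta>, \<one>]"] \<Delta> by (simp del: Span.simps)
  then have "z \<in> line_extension k \<Delta> (Span k [\<one>])" using assms by simp
  then obtain b a where "b \<in> k" "a \<in> Span k [\<one>]" "z = b \<otimes> \<Delta> \<oplus> a"
    using line_extension_mem_iff by blast
  moreover from this have "a \<in> k" using \<open>k = Span k [\<one>]\<close> by simp
  ultimately show ?thesis using that[of a b] \<Delta> by (simp add: a_comm)
qed

text \<open>If the coefficients of \<Delta> differed, \<Delta> would be a quotient of elements of
  \<open>k\<close>.\<close>

lemma rep_unique:
  assumes ab: "a \<in> k" "b \<in> k" "a' \<in> k" "b' \<in> k" and eq: "a \<oplus> b \<otimes> \<Delta> = a' \<oplus> b' \<otimes> \<Delta>"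
  shows "a = a'" "b = b'"
proof -
  have c: "a \<in> carrier R" "b \<in> carrier R" "a' \<in> carrier R" "b' \<in> carrier R" using ab by auto
  have e1: "(b \<ominus> b') \<otimes> \<Delta> = (a \<oplus> b \<otimes> \<Delta>) \<ominus> (a' \<oplus> b' \<otimes> \<Delta>) \<oplus> (a' \<ominus> a)"
    using c \<Delta> by algebra
  then have e: "(b \<ominus> b') \<otimes> \<Delta> = a' \<ominus> a"
    unfolding eq using c \<Delta> by algebra
  have bz: "b \<ominus> b' = \<zero>"
  proof (rule ccontr)
    assume nz: "b \<ominus> b' \<noteq> \<zero>"
    have i: "inv (b \<ominus> b') \<in> k" using nz ab by (intro k_inv) auto
    have "inv (b \<ominus> b') \<otimes> (b \<ominus> b') = \<one>" using nz c field_Units by auto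
    then have "\<Delta> = inv (b \<ominus> b') \<otimes> ((b \<ominus> b') \<otimes> \<Delta>)"
      using i c \<Delta> by (simp add: m_assoc[symmetric])
    also have "\<dots> = inv (b \<ominus> b') \<otimes> (a' \<ominus> a)" using e by simp
    also have "\<dots> \<in> k" using i ab by simp
    finally show False using \<Delta>_notin by simp
  qed
  then show "b = b'" using c by simp
  have "a' \<ominus> a = \<zero>" using e \<Delta> unfolding bz by simp
  then show "a = a'" using c by simp
qed

text \<open>By \<open>rep_unique\<close> the description operator in \<open>quad_conj\<close> has
  exactly one candidate.\<close>

lemma conj_rep:
  assumes "a \<in> k" "b \<in> k"
  shows "quad_conj R k \<Delta> (a \<oplus> b \<otimes> \<Delta>) = a \<ominus> b \<otimes> \<Delta>"
  unfolding quad_conj_def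
proof (rule the_equality)
  show "\<exists>a'\<in>k. \<exists>b'\<in>k. a \<oplus> b \<otimes> \<Delta> = a' \<oplus> b' \<otimes> \<Delta> \<and> a \<ominus> b \<otimes> \<Delta> = a' \<ominus> b' \<otimes> \<Delta>"
    using assms by blast
qed (use assms rep_unique in blast)

section \<open>Cardinalities, and conjugation as the \<open>q\<close>-th power map\<close>

lemma fin_carrier: "finite (carrier R)" and card_carrier: "card (carrier R) = q * q"
proof -
  have im: "carrier R = (\<lambda>(a, b). a \<oplus> b \<otimes> \<Delta>) ` (k \<times> k)"
  proof
    show "carrier R \<subseteq> (\<lambda>(a, b). a \<oplus> b \<otimes> \<Delta>) ` (k \<times> k)"
    proof
      fix z assume "z \<in> carrier R"
      from rep[OF this] obtain a b where "a \<in> k" "b \<in> k" "z = a \<oplus> b \<otimes> \<Delta>" .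
      then show "z \<in> (\<lambda>(a, b). a \<oplus> b \<otimes> \<Delta>) ` (k \<times> k)" by (intro image_eqI[of _ _ "(a, b)"]) auto
    qed
  qed (use \<Delta> in auto)
  have inj: "inj_on (\<lambda>(a, b). a \<oplus> b \<otimes> \<Delta>) (k \<times> k)"
    using rep_unique by (auto simp: inj_on_def)
  show "finite (carrier R)" unfolding im using fin_k by simp
  show "card (carrier R) = q * q"
    unfolding im using inj by (simp add: card_image card_cartesian_product card_k)
qed

lemma q_gt_1: "q > 1"
proof -
  have "{\<zero>, \<one>} \<subseteq> k" by simp
  then have "card {\<zero>, \<one>} \<le> card k" using fin_k card_mono by blast
  then show ?thesis using card_k by simp
qed

text \<open>Lagrange's theorem in the multiplicative group of \<open>k\<close>, of order
  \<open>q - 1\<close>.\<close>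

lemma k_pow_q: "x \<in> k \<Longrightarrow> x [^] q = x"
proof (cases "x = \<zero>")
  case True
  then show ?thesis using q_gt_1 by (simp add: nat_pow_zero)
next
  case False
  assume x: "x \<in> k"
  interpret k: field "R\<lparr>carrier := k\<rparr>" by (rule k_field)
  interpret km: group "Multiplicative_Group.mult_of (R\<lparr>carrier := k\<rparr>)" by (rule k.field_mult_group)
  have "x [^] (q - 1) = \<one>"
    using km.pow_order_eq_1[of x] x False k.order_mult_of fin_k card_k
    by (simp add: order_def nat_pow_mult_of) (simp add: nat_pow_def)
  then have "x [^] Suc (q - 1) = x" using x by simp
  then show ?thesis using q_gt_1 by simp
qed

lemma \<Delta>_pow_odd: "odd (m::nat) \<Longrightarrow> \<exists>d\<in>k. d \<noteq> \<zero> \<and> \<Delta> [^] m = d \<otimes> \<Delta>"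
proof -
  assume "odd m"
  then obtain h where h: "m = Suc (2 * h)" by (auto elim: oddE)
  have "\<Delta> [^] m = (\<Delta> [^] (2::nat)) [^] h \<otimes> \<Delta>"
    unfolding h using \<Delta> by (simp add: nat_pow_pow)
  moreover have "(\<Delta> [^] (2::nat)) [^] h \<noteq> \<zero>"
    using \<Delta> \<Delta>_nz by (intro pow_nonzero) auto
  ultimately show ?thesis using \<Delta>2 k_pow by blast
qed

text \<open>The square of \<Delta> lies in \<open>k\<close> and is fixed by the \<open>q\<close>-th
  power, so the \<open>q\<close>-th power of \<Delta> is \<Delta> up to sign. A plus sign would make
  the \<open>q\<close>-th power map the identity, and all \<open>q * q - 1\<close> nonzero elements
  would be roots of \<open>X^(q-1) - 1\<close>.\<close>

lemma \<Delta>_pow_q: "\<Delta> [^] q = \<ominus> \<Delta>"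
proof -
  let ?x = "\<Delta> [^] q"
  have x: "?x \<in> carrier R" using \<Delta> by simp
  have "odd q" using odd_p q by simp
  then obtain d where d: "d \<in> k" "?x = d \<otimes> \<Delta>" using \<Delta>_pow_odd by blast
  have "?x [^] (2::nat) = (\<Delta> [^] (2::nat)) [^] q"
    using \<Delta> by (simp add: nat_pow_pow mult.commute)
  also have "\<dots> = \<Delta> [^] (2::nat)" using k_pow_q \<Delta>2 by simp
  finally have "?x \<otimes> ?x = \<Delta> \<otimes> \<Delta>" using \<Delta> x by (simp add: numeral_2_eq_2)
  moreover have "(?x \<ominus> \<Delta>) \<otimes> (?x \<oplus> \<Delta>) = ?x \<otimes> ?x \<ominus> \<Delta> \<otimes> \<Delta>" using x \<Delta> by algebra
  ultimately have "(?x \<ominus> \<Delta>) \<otimes> (?x \<oplus> \<Delta>) = \<zero>" using x \<Delta> by simp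
  then consider "?x \<ominus> \<Delta> = \<zero>" | "?x \<oplus> \<Delta> = \<zero>" using x \<Delta> integral by blast
  then show ?thesis
  proof cases
    case 1
    then have fixed: "?x = \<Delta>" using x \<Delta> by simp
    have "z [^] q = z" if z: "z \<in> carrier R" for z
    proof -
      obtain a b where "a \<in> k" "b \<in> k" "z = a \<oplus> b \<otimes> \<Delta>" using rep[OF z] .
      then show ?thesis
        using \<Delta> fixed frobenius_pow_add[OF p char, of a "b \<otimes> \<Delta>" t] k_pow_q
        by (simp add: q[symmetric] nat_pow_distrib)
    qed
    then have "z [^] (q - 1) = \<one>" if "z \<in> carrier R" "z \<noteq> \<zero>" for z
    proof -
      have "z [^] Suc (q - 1) = z" using that q_gt_1 \<open>\<And>z. z \<in> carrier R \<Longrightarrow> z [^] q = z\<close> by simp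
      then have "z [^] (q - 1) \<otimes> z = \<one> \<otimes> z" using that by simp
      then show ?thesis using that m_rcancel by (metis nat_pow_closed one_closed)
    qed
    then have "carrier R - {\<zero>} \<subseteq> {x \<in> carrier R. x [^] (q - 1) = \<one>}" by auto
    then have "card (carrier R - {\<zero>}) \<le> card {x \<in> carrier R. x [^] (q - 1) = \<one>}"
      using fin_carrier by (intro card_mono) auto
    also have "\<dots> \<le> q - 1" using q_gt_1 by (intro num_roots_le_deg[OF fin_carrier]) auto
    finally have "q * q - 1 \<le> q - 1" using card_carrier fin_carrier by simp
    moreover have "2 * q \<le> q * q" using q_gt_1 by simp
    ultimately show ?thesis using q_gt_1 by linarith
  next
    case 2
    then show ?thesis using x \<Delta> by (metis minus_equality)
  qed
qed

text \<open>The \<open>q\<close>-th power fixes the coordinates in \<open>k\<close> and negates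
  \<Delta>. From this, conjugation inherits additivity and multiplicativity from Frobenius.\<close>

lemma conj_eq_pow:
  assumes z: "z \<in> carrier R"
  shows "quad_conj R k \<Delta> z = z [^] q"
proof -
  obtain a b where ab: "a \<in> k" "b \<in> k" "z = a \<oplus> b \<otimes> \<Delta>" using rep[OF z] .
  then have "z [^] q = a \<oplus> b \<otimes> (\<ominus> \<Delta>)"
    using \<Delta> \<Delta>_pow_q frobenius_pow_add[OF p char, of a "b \<otimes> \<Delta>" t] k_pow_q
    by (simp add: q[symmetric] nat_pow_distrib)
  then show ?thesis using ab conj_rep \<Delta> by (simp add: r_minus minus_eq)
qed

lemma conj_hom: "quad_conj R k \<Delta> \<in> ring_hom R R"
proof (rule ring_hom_memI)
  fix x y assume xy: "x \<in> carrier R" "y \<in> carrier R"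
  show "quad_conj R k \<Delta> x \<in> carrier R" using xy by (simp add: conj_eq_pow)
  show "quad_conj R k \<Delta> (x \<otimes> y) = quad_conj R k \<Delta> x \<otimes> quad_conj R k \<Delta> y"
    using xy by (simp add: conj_eq_pow nat_pow_distrib)
  show "quad_conj R k \<Delta> (x \<oplus> y) = quad_conj R k \<Delta> x \<oplus> quad_conj R k \<Delta> y"
    using xy frobenius_pow_add[OF p char, of x y t] by (simp add: conj_eq_pow q[symmetric])
qed (simp add: conj_eq_pow)

lemma conj_conj:
  assumes z: "z \<in> carrier R"
  shows "quad_conj R k \<Delta> (quad_conj R k \<Delta> z) = z"
proof -
  obtain a b where ab: "a \<in> k" "b \<in> k" "z = a \<oplus> b \<otimes> \<Delta>" using rep[OF z] .
  have "quad_conj R k \<Delta> (a \<oplus> (\<ominus> b) \<otimes> \<Delta>) = a \<oplus> b \<otimes> \<Delta>"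
    using ab \<Delta> by (subst conj_rep) (auto simp: l_minus minus_eq)
  then show ?thesis using ab \<Delta> by (simp add: conj_rep l_minus minus_eq)
qed

lemma conj_k: "x \<in> k \<Longrightarrow> quad_conj R k \<Delta> x = x"
  by (simp add: conj_eq_pow k_pow_q)

lemma conj_\<Delta>: "quad_conj R k \<Delta> \<Delta> = \<ominus> \<Delta>"
  using \<Delta> by (simp add: conj_eq_pow \<Delta>_pow_q)

text \<open>Comparing coordinates gives \<open>b = \<ominus> b\<close>, which forces
  \<open>b = \<zero>\<close> in odd characteristic; \<open>conj_neg\<close> is the same argument for
  the other coordinate.\<close>

lemma conj_fixed:
  assumes z: "z \<in> carrier R" and "quad_conj R k \<Delta> z = z"
  shows "z \<in> k"
proof -
  obtain a b where ab: "a \<in> k" "b \<in> k" "z = a \<oplus> b \<otimes> \<Delta>" using rep[OF z] .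
  then have "a \<oplus> b \<otimes> \<Delta> = a \<oplus> (\<ominus> b) \<otimes> \<Delta>"
    using assms(2) conj_rep \<Delta> by (simp add: l_minus minus_eq)
  then have "b = \<ominus> b" using ab rep_unique(2)[of a b a "\<ominus> b"] by simp
  then have "b \<oplus> b = \<zero>" using ab by (metis k_sub r_neg)
  then have "b = \<zero>" by (rule double_zero[OF k_sub[OF ab(2)]])
  then show ?thesis using ab \<Delta> by simp
qed

lemma conj_neg:
  assumes z: "z \<in> carrier R" and "quad_conj R k \<Delta> z = \<ominus> z"
  shows "\<exists>b\<in>k. z = b \<otimes> \<Delta>"
proof -
  obtain a b where ab: "a \<in> k" "b \<in> k" "z = a \<oplus> b \<otimes> \<Delta>" using rep[OF z] .
  have "\<ominus> z = (\<ominus> a) \<oplus> (\<ominus> b) \<otimes> \<Delta>"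
    using ab \<Delta> by (simp add: minus_add l_minus)
  then have "a \<oplus> (\<ominus> b) \<otimes> \<Delta> = (\<ominus> a) \<oplus> (\<ominus> b) \<otimes> \<Delta>"
    using assms(2) ab conj_rep \<Delta> by (simp add: l_minus minus_eq)
  then have "a = \<ominus> a" using ab rep_unique(1)[of a "\<ominus> b" "\<ominus> a" "\<ominus> b"] by simp
  then have "a \<oplus> a = \<zero>" using ab by (metis k_sub r_neg)
  then have "a = \<zero>" by (rule double_zero[OF k_sub[OF ab(1)]])
  then show ?thesis using ab \<Delta> by auto
qed

text \<open>The norm of \<open>x\<close> is \<open>x^(q+1)\<close>, and the multiplicative group is
  cyclic of order \<open>(q - 1) * (q + 1)\<close>. Hence a power of its generator \<open>g\<close>
  has norm one exactly when \<open>q - 1\<close> divides the exponent.\<close>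

lemma norm_one_generator:
  obtains c where "c \<in> carrier R" "\<And>m. c [^] (m::nat) = \<one> \<longleftrightarrow> (q + 1) dvd m"
    "\<And>x. x \<in> carrier R \<Longrightarrow> x \<otimes> quad_conj R k \<Delta> x = \<one> \<longleftrightarrow> (\<exists>m::nat. x = c [^] m)"
proof -
  interpret M: group "Multiplicative_Group.mult_of R" by (rule field_mult_group)
  obtain g where g: "g \<in> carrier (Multiplicative_Group.mult_of R)" "carrier (Multiplicative_Group.mult_of R) = {g [^] i | i::nat. i \<in> UNIV}"
    using finite_field_mult_group_has_gen[OF fin_carrier] by blast
  have finM: "finite (carrier (Multiplicative_Group.mult_of R))" using fin_carrier by simp
  have "generate (Multiplicative_Group.mult_of R) {g} = carrier (Multiplicative_Group.mult_of R)"
    using M.generate_pow_on_finite_carrier[OF finM g(1)] g(2) by (simp add: Multiplicative_Group.nat_pow_mult_of)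
  then have "M.ord g = card (carrier (Multiplicative_Group.mult_of R))" using M.generate_pow_card[OF g(1)] by simp
  also have "\<dots> = (q - 1) * (q + 1)"
    using card_carrier fin_carrier q_gt_1 by (simp add: algebra_simps)
  finally have ord: "M.ord g = (q - 1) * (q + 1)" .
  have gR: "g \<in> carrier R" using g by simp
  have pow1: "g [^] (m::nat) = \<one> \<longleftrightarrow> (q - 1) * (q + 1) dvd m" for m
    using M.pow_eq_id[OF g(1), of m] ord by (simp add: Multiplicative_Group.nat_pow_mult_of)
  let ?c = "g [^] (q - 1)"
  have c1: "?c [^] m = \<one> \<longleftrightarrow> (q + 1) dvd m" for m :: nat
  proof -
    have "?c [^] m = g [^] ((q - 1) * m)" using gR by (simp add: nat_pow_pow)
    then have "?c [^] m = \<one> \<longleftrightarrow> (q - 1) * (q + 1) dvd (q - 1) * m" using pow1 by (simp only:)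
    then show ?thesis using q_gt_1 by (simp only:) (rule dvd_times_left_cancel_iff, simp)
  qed
  have "x \<otimes> quad_conj R k \<Delta> x = \<one> \<longleftrightarrow> (\<exists>m::nat. x = ?c [^] m)" if x: "x \<in> carrier R" for x
  proof -
    have e: "x \<otimes> quad_conj R k \<Delta> x = x [^] (q + 1)"
      using x by (simp add: conj_eq_pow m_comm)
    show ?thesis unfolding e
    proof
      assume 1: "x [^] (q + 1) = \<one>"
      then have "x \<noteq> \<zero>" by (auto simp: nat_pow_zero)
      then obtain i :: nat where i: "x = g [^] i" using g(2) x by auto
      have "g [^] (i * (q + 1)) = \<one>" using 1 gR unfolding i by (simp only: nat_pow_pow)
      then have "(q - 1) * (q + 1) dvd i * (q + 1)" using pow1 by blast
      then have "q - 1 dvd i" by (subst (asm) dvd_times_right_cancel_iff) auto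
      then obtain m where "i = (q - 1) * m" by auto
      then show "\<exists>m::nat. x = ?c [^] m" using i gR by (auto simp: nat_pow_pow)
    next
      assume "\<exists>m::nat. x = ?c [^] m"
      then obtain m :: nat where "x = ?c [^] m" by auto
      then have "x [^] (q + 1) = ?c [^] (m * (q + 1))" using gR by (simp only: nat_pow_pow nat_pow_closed mult.assoc)
      also have "\<dots> = \<one>" unfolding c1 by (rule dvd_triv_right)
      finally show "x [^] (q + 1) = \<one>" .
    qed
  qed
  then show ?thesis using that[of ?c] c1 gR by simp
qed

section \<open>The basis of \<open>k\<close> over the prime field and its Frobenius twists\<close>

lemma prime_field: "generate_field R {} = {add_pow R (m::nat) \<one> | m. True}"
proof
  have "add_pow R m \<one> \<in> generate_field R {}" for m :: nat
    by (induction m) (auto intro: zero_in_generate generate_field.intros)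
  then show "{add_pow R (m::nat) \<one> | m. True} \<subseteq> generate_field R {}" by auto
  show "generate_field R {} \<subseteq> {add_pow R (m::nat) \<one> | m. True}"
  proof
    fix h assume "h \<in> generate_field R {}"
    then show "h \<in> {add_pow R (m::nat) \<one> | m. True}"
    proof (induction rule: generate_field.induct)
      case one
      have "\<one> = add_pow R (1::nat) \<one>" by simp
      then show ?case by blast
    next
      \<comment> \<open>The negative of \<open>m\<close> is represented by the natural number
        \<open>m * (p - 1)\<close>, since the two add up to \<open>p * m\<close>.\<close>
      case (a_inv h)
      then obtain m :: nat where m: "h = add_pow R m \<one>" by auto
      have "add_pow R (m * (p - 1)) \<one> \<oplus> h = add_pow R (m * (p - 1) + m) \<one>"
        unfolding m by (simp add: add.nat_pow_mult)
      also have "m * (p - 1) + m = p * m" using prime_gt_0_nat[OF p] by (cases p) auto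
      also have "add_pow R (p * m) \<one> = \<zero>" by (rule char_dvd) simp
      finally have "\<ominus> h = add_pow R (m * (p - 1)) \<one>" using m by (intro minus_equality) auto
      then show ?case by blast
    next
      \<comment> \<open>The inverse of \<open>m\<close> modulo \<open>p\<close> comes from
        Bezout.\<close>
      case (m_inv h)
      then obtain m :: nat where m: "h = add_pow R m \<one>" by blast
      have "\<not> p dvd m" using m_inv.hyps(2) char_iff unfolding m by simp
      then have "coprime m p" using p by (metis coprime_commute prime_imp_coprime)
      then obtain u v where uv: "m * u = p * v + 1"
        using bezout_nat[of m p] \<open>\<not> p dvd m\<close> by (metis coprime_iff_gcd_eq_1 dvd_0_right)
      have "add_pow R (m * u) \<one> = \<one>" unfolding uv using char_dvd[of "p * v"] by simp
      then have "h \<otimes> add_pow R u \<one> = \<one>" unfolding m by (simp add: add_pow_mult)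
      then have "inv h = add_pow R u \<one>" using m by (intro comm_inv_char) auto
      then show ?case by blast
    next
      case (eng_add h1 h2)
      then obtain m1 m2 :: nat where "h1 = add_pow R m1 \<one>" "h2 = add_pow R m2 \<one>" by auto
      then have "h1 \<oplus> h2 = add_pow R (m1 + m2) \<one>" by (simp add: add.nat_pow_mult)
      then show ?case by blast
    next
      case (eng_mult h1 h2)
      then obtain m1 m2 :: nat where "h1 = add_pow R m1 \<one>" "h2 = add_pow R m2 \<one>" by auto
      then have "h1 \<otimes> h2 = add_pow R (m1 * m2) \<one>" by (simp add: add_pow_mult)
      then show ?case by blast
    qed auto
  qed
qed

lemma e_carrier: "l \<in> {1..t} \<Longrightarrow> e l \<in> carrier R"
  using independent_in_carrier[OF indep] by (auto simp del: upt_Suc)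

lemma prime_subfield: "subfield (generate_field R {}) R"
  by (rule generate_field_is_subfield) simp

text \<open>Prime field scalars become natural multiples, the form in which exponents of group
  elements act on leading coefficients.\<close>

lemma combine_e:
  "combine (map (\<lambda>l. add_pow R (m l :: nat) \<one>) [1..<Suc t]) (map e [1..<Suc t])
    = (\<Oplus>l\<in>{1..t}. add_pow R (m l) (e l))"
proof -
  have s: "set [1..<Suc t] = {1..t}" by auto
  have "combine (map (\<lambda>l. add_pow R (m l :: nat) \<one>) [1..<Suc t]) (map e [1..<Suc t])
    = (\<Oplus>l\<in>set [1..<Suc t]. add_pow R (m l) \<one> \<otimes> e l)"
    using e_carrier by (intro combine_map) auto
  also have "\<dots> = (\<Oplus>l\<in>{1..t}. add_pow R (m l) (e l))"
    unfolding s using e_carrier by (intro finsum_cong') (auto simp: add_pow_eq_mult[symmetric])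
  finally show ?thesis .
qed

lemma basis_indep:
  assumes "(\<Oplus>l\<in>{1..t}. add_pow R (m l :: nat) (e l)) = \<zero>" "l \<in> {1..t}"
  shows "add_pow R (m l) \<one> = \<zero>"
proof -
  let ?K = "map (\<lambda>l. add_pow R (m l) \<one>) [1..<Suc t]"
  have "set (take (length (map e [1..<Suc t])) ?K) \<subseteq> {\<zero>}"
    using assms(1) combine_e prime_field
    by (intro independent_imp_trivial_combine[OF prime_subfield indep]) auto
  then have "set ?K \<subseteq> {\<zero>}" by simp
  moreover have "add_pow R (m l) \<one> \<in> set ?K"
    unfolding set_map using assms(2) by (intro imageI) (auto simp del: upt_Suc)
  ultimately show ?thesis by blast
qed

lemma basis_span:
  assumes "s \<in> k"
  obtains m :: "nat \<Rightarrow> nat" where "s = (\<Oplus>l\<in>{1..t}. add_pow R (m l) (e l))"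
proof -
  obtain Ks where Ks: "length Ks = t" "set Ks \<subseteq> generate_field R {}" "s = combine Ks (map e [1..<Suc t])"
    using assms Span_eq_combine_set_length_version[OF prime_subfield independent_in_carrier[OF indep]]
    unfolding span by (auto simp del: upt_Suc)
  \<comment> \<open>The list \<open>Ks\<close> is indexed from 0 and the basis from 1, hence
    \<open>l - 1\<close>.\<close>
  have "\<forall>l\<in>{1..t}. \<exists>m::nat. Ks ! (l - 1) = add_pow R m \<one>"
  proof
    fix l assume "l \<in> {1..t}"
    then have "Ks ! (l - 1) \<in> set Ks" using Ks(1) by (intro nth_mem) auto
    then show "\<exists>m::nat. Ks ! (l - 1) = add_pow R m \<one>" using Ks(2) prime_field by blast
  qed
  then obtain m :: "nat \<Rightarrow> nat" where m: "\<forall>l\<in>{1..t}. Ks ! (l - 1) = add_pow R (m l) \<one>"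
    by metis
  have "Ks = map (\<lambda>l. add_pow R (m l) \<one>) [1..<Suc t]"
  proof (rule nth_equalityI)
    fix i assume "i < length Ks"
    then have "i < t" "Suc i \<in> {1..t}" using Ks(1) by auto
    then show "Ks ! i = map (\<lambda>l. add_pow R (m l) \<one>) [1..<Suc t] ! i"
      using bspec[OF m, of "Suc i"] by (simp del: upt_Suc)
  qed (simp add: Ks(1) del: upt_Suc)
  then show ?thesis using that[of m] Ks(3) combine_e by simp
qed

text \<open>Frobenius is additive and commutes with natural multiples, so a combination of twisted
  basis elements is the twist of the untwisted combination.\<close>

lemma frobenius_combination:
  assumes \<delta>: "\<delta> \<in> carrier R"
  shows "(\<Oplus>l\<in>{1..t}. add_pow R (m l :: nat) ((e l \<otimes> \<delta>) [^] (p ^ r)))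
    = (\<Oplus>l\<in>{1..t}. add_pow R (m l) (e l)) [^] (p ^ r) \<otimes> \<delta> [^] (p ^ r)"
proof -
  have "(\<Oplus>l\<in>{1..t}. add_pow R (m l) (e l)) \<otimes> \<delta> = (\<Oplus>l\<in>{1..t}. add_pow R (m l) (e l \<otimes> \<delta>))"
    using e_carrier \<delta> by (subst finsum_ldistr) (auto intro!: finsum_cong' simp: add_pow_ldistr)
  then have "(\<Oplus>l\<in>{1..t}. add_pow R (m l) (e l)) [^] (p ^ r) \<otimes> \<delta> [^] (p ^ r)
      = (\<Oplus>l\<in>{1..t}. add_pow R (m l) (e l \<otimes> \<delta>)) [^] (p ^ r)"
    using e_carrier \<delta> by (subst nat_pow_distrib[symmetric]) auto
  also have "\<dots> = (\<Oplus>l\<in>{1..t}. add_pow R (m l) (e l \<otimes> \<delta>) [^] (p ^ r))"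
    using e_carrier \<delta> by (intro frobenius_pow_finsum[OF p char]) auto
  also have "\<dots> = (\<Oplus>l\<in>{1..t}. add_pow R (m l) ((e l \<otimes> \<delta>) [^] (p ^ r)))"
    using e_carrier \<delta> by (intro finsum_cong') (auto simp: frobenius_pow_add_pow[OF p char])
  finally show ?thesis by simp
qed

text \<open>By \<open>frobenius_combination\<close>, cancelling the power of \<delta> and undoing
  Frobenius reduces the claim to \<open>basis_indep\<close>.\<close>

lemma twisted_indep:
  assumes "\<delta> \<in> carrier R" "\<delta> \<noteq> \<zero>"
    and "(\<Oplus>l\<in>{1..t}. add_pow R (m l :: nat) ((e l \<otimes> \<delta>) [^] (p ^ r))) = \<zero>" "l \<in> {1..t}"
  shows "add_pow R (m l) \<one> = \<zero>"
proof -
  let ?s = "\<Oplus>l\<in>{1..t}. add_pow R (m l) (e l)"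
  have s: "?s \<in> carrier R" using e_carrier by auto
  have "?s [^] (p ^ r) \<otimes> \<delta> [^] (p ^ r) = \<zero>"
    using assms frobenius_combination by simp
  then have "?s = \<zero>"
    using s assms(1,2) integral_iff pow_nonzero by (metis nat_pow_closed)
  then show ?thesis using basis_indep assms(4) by blast
qed

text \<open>Frobenius is injective on the finite set \<open>k\<close>, hence onto: \<open>s\<close>
  is the twist of some \<open>u\<close>, and \<open>u\<close> is expanded in the basis.\<close>

lemma twisted_span:
  assumes \<delta>: "\<delta> \<in> carrier R" and s: "s \<in> k"
  obtains m :: "nat \<Rightarrow> nat" where
    "s \<otimes> \<delta> [^] (p ^ r) = (\<Oplus>l\<in>{1..t}. add_pow R (m l) ((e l \<otimes> \<delta>) [^] (p ^ r)))"
proof -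
  have "inj_on (\<lambda>x. x [^] (p ^ r)) k"
    using frobenius_pow_inj[OF p char k_sub k_sub] by (intro inj_onI)
  then have "(\<lambda>x. x [^] (p ^ r)) ` k = k"
    using fin_k by (intro endo_inj_surj image_subsetI k_pow)
  with s have "s \<in> (\<lambda>x. x [^] (p ^ r)) ` k" by (simp only:)
  then obtain u where u: "u \<in> k" "s = u [^] (p ^ r)" by blast
  obtain m :: "nat \<Rightarrow> nat" where "u = (\<Oplus>l\<in>{1..t}. add_pow R (m l) (e l))"
    using basis_span[OF u(1)] .
  then show ?thesis using that[of m] u frobenius_combination[OF \<delta>, of m r] by simp
qed

text \<open>The \<open>k\<close>-multiples of \<open>\<delta> i\<close> are the values that
  \<open>W_lead\<close> allows for a leading coefficient in degree \<open>i\<close>.\<close>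

definition \<delta> :: "nat \<Rightarrow> 'a" where "\<delta> i = (if odd i then \<one> else \<Delta>)"

lemma \<delta>_closed [simp]: "\<delta> i \<in> carrier R" and \<delta>_nz: "\<delta> i \<noteq> \<zero>"
  using \<Delta> \<Delta>_nz by (auto simp: \<delta>_def)

text \<open>The premise \<open>lead\<close> is what \<open>W_lead\<close> gives in degree
  \<open>i * p ^ r\<close>, whose parity is that of \<open>i\<close>. For even \<open>i\<close> the
  value is a \<open>k\<close>-multiple of \<Delta>; as \<open>p ^ r\<close> is odd, the power of
  \<Delta> is a nonzero \<open>k\<close>-multiple of \<Delta>, so one can be traded for the
  other.\<close>

lemma lead_coeff:
  assumes x: "x \<in> carrier R"
    and lead: "(if even (i * p ^ r) then quad_conj R k \<Delta> x else \<ominus> quad_conj R k \<Delta> x) = \<ominus> x"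
  shows "\<exists>s\<in>k. x = s \<otimes> \<delta> i [^] (p ^ r)"
proof (cases "odd i")
  case True
  then have "\<ominus> quad_conj R k \<Delta> x = \<ominus> x" using lead odd_p by simp
  then have "quad_conj R k \<Delta> x = x"
    using x conj_eq_pow by (metis minus_minus nat_pow_closed)
  then have "x \<in> k" using conj_fixed x by blast
  then show ?thesis using True x by (intro bexI[of _ x]) (auto simp: \<delta>_def)
next
  case False
  then have "quad_conj R k \<Delta> x = \<ominus> x" using lead by simp
  then obtain b where b: "b \<in> k" "x = b \<otimes> \<Delta>" using conj_neg x by blast
  have "odd (p ^ r)" using odd_p by simp
  then obtain d where d: "d \<in> k" "d \<noteq> \<zero>" "\<Delta> [^] (p ^ r) = d \<otimes> \<Delta>" using \<Delta>_pow_odd by blast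
  have "inv d \<otimes> d = \<one>" using d field_Units by auto
  then have "(b \<otimes> inv d) \<otimes> (d \<otimes> \<Delta>) = b \<otimes> \<Delta>"
    using b d \<Delta> k_inv[OF d(1,2)] by (metis k_sub l_one m_assoc m_closed)
  then show ?thesis using False b d k_inv[OF d(1,2)]
    by (intro bexI[of _ "b \<otimes> inv d"]) (auto simp: \<delta>_def)
qed

end

section \<open>The generators are unitary\<close>

context trunc_poly
begin

text \<open>\<open>f\<close> is a polynomial in \<open>x^i\<close>. The bound on \<open>n\<close>
  ensures that each \<open>c\<close> with \<open>c * i < n\<close> is at most \<open>m\<close>, so
  no coefficient below \<open>n\<close> is lost by stopping the sum at \<open>m\<close>.\<close>

lemma coeff_sparse:
  assumes \<beta>: "\<And>j. j \<in> {1..m} \<Longrightarrow> \<beta> j \<in> carrier R" and i: "i \<ge> 1"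
    and m: "n \<le> (m + 1) * i" and f: "f = \<one>\<^bsub>P\<^esub> \<oplus>\<^bsub>P\<^esub> (\<Oplus>\<^bsub>P\<^esub>j\<in>{1..m}. up_ring.monom P (\<beta> j) (j * i))"
  shows "f \<in> carrier P"
    and "c * i < n \<Longrightarrow> up_ring.coeff P f (c * i) = (if c = 0 then \<one> else \<beta> c)"
    and "\<not> i dvd d \<Longrightarrow> up_ring.coeff P f d = \<zero>"
proof -
  have mc: "(\<lambda>j. up_ring.monom P (\<beta> j) (j * i)) \<in> {1..m} \<rightarrow> carrier P" using \<beta> by auto
  then show fP: "f \<in> carrier P" unfolding f by (intro P.a_closed P.finsum_closed) auto
  have co: "up_ring.coeff P f d = (if d = 0 then \<one> else \<zero>) \<oplus>
      (\<Oplus>j\<in>{1..m}. if j * i = d then \<beta> j else \<zero>)" for d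
  proof -
    have "up_ring.coeff P f d = (if d = 0 then \<one> else \<zero>) \<oplus>
        (\<Oplus>j\<in>{1..m}. up_ring.coeff P (up_ring.monom P (\<beta> j) (j * i)) d)"
      unfolding f using mc by (simp add: coeff_finsum P.finsum_closed)
    also have "(\<Oplus>j\<in>{1..m}. up_ring.coeff P (up_ring.monom P (\<beta> j) (j * i)) d)
        = (\<Oplus>j\<in>{1..m}. if j * i = d then \<beta> j else \<zero>)"
      using \<beta> by (intro R.finsum_cong') auto
    finally show ?thesis .
  qed
  show "up_ring.coeff P f (c * i) = (if c = 0 then \<one> else \<beta> c)" if c: "c * i < n"
  proof (cases "c = 0")
    case True
    have "(\<Oplus>j\<in>{1..m}. if j * i = 0 then \<beta> j else \<zero>) = \<zero>"
      using i by (intro R.add.finprod_one_eqI) auto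
    then show ?thesis using True co[of 0] by simp
  next
    case False
    have "c * i < (m + 1) * i" using c m by linarith
    then have cm: "c \<in> {1..m}" using False by (auto simp del: mult_Suc)
    have "(\<Oplus>j\<in>{1..m}. if j * i = c * i then \<beta> j else \<zero>) = (\<Oplus>j\<in>{1..m}. if c = j then \<beta> j else \<zero>)"
      using i \<beta> by (intro R.finsum_cong') auto
    also have "\<dots> = \<beta> c" using cm \<beta> by (intro R.add.finprod_singleton) auto
    finally show ?thesis using False i co[of "c * i"] \<beta>[OF cm] by simp
  qed
  show "up_ring.coeff P f d = \<zero>" if "\<not> i dvd d"
  proof -
    have "(\<Oplus>j\<in>{1..m}. if j * i = d then \<beta> j else \<zero>) = \<zero>"
      using that by (intro R.add.finprod_one_eqI) auto
    moreover have "d \<noteq> 0" using that by (metis dvd_0_right)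
    ultimately show ?thesis using co[of d] by simp
  qed
qed

lemma finsum_multiples:
  assumes i: "i \<ge> (1::nat)" and g: "\<And>a. g a \<in> carrier R" and z: "\<And>a. \<not> i dvd a \<Longrightarrow> g a = \<zero>"
  shows "(\<Oplus>a\<in>{..c * i}. g a) = (\<Oplus>s\<in>{..c}. g (s * i))"
proof -
  have "(\<Oplus>a\<in>{..c * i}. g a) = (\<Oplus>a\<in>(\<lambda>s. s * i) ` {..c}. g a)"
  proof (rule R.add.finprod_mono_neutral_cong_right)
    fix a assume a: "a \<in> {..c * i} - (\<lambda>s. s * i) ` {..c}"
    have "\<not> i dvd a"
    proof
      assume "i dvd a"
      then obtain s where "a = s * i" by (metis dvd_div_mult_self)
      moreover from this have "s \<le> c" using a i by simp
      ultimately show False using a by auto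
    qed
    then show "g a = \<zero>" by (rule z)
  qed (use g i in auto)
  also have "\<dots> = (\<Oplus>s\<in>{..c}. g (s * i))"
    using g i by (intro R.finsum_reindex) (auto simp: inj_on_def)
  finally show ?thesis .
qed

end

context trunc_unitary
begin

text \<open>The product of \<open>f\<close> with its image under the involution has, below degree
  \<open>n\<close>, only terms in degrees \<open>c * i\<close>. Their coefficients are the
  convolutions in \<open>conv\<close>, and they vanish for \<open>c \<ge> 1\<close>.\<close>

lemma sparse_in_W:
  assumes \<beta>: "\<And>j. \<beta> j \<in> carrier R" and \<beta>0: "\<beta> 0 = \<one>" and i: "i \<ge> 1"
    and m: "n \<le> (m + 1) * i"
    and f: "f = \<one>\<^bsub>P\<^esub> \<oplus>\<^bsub>P\<^esub> (\<Oplus>\<^bsub>P\<^esub>j\<in>{1..m}. up_ring.monom P (\<beta> j) (j * i))"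
    and conv: "\<And>c. c \<ge> 1 \<Longrightarrow>
      (\<Oplus>s\<in>{..c}. \<beta> s \<otimes> sg ((c - s) * i) (\<sigma> (\<beta> (c - s)))) = \<zero>"
  shows "tp f \<in> W i" "i < n \<Longrightarrow> cf (tp f) i = \<beta> 1"
proof -
  note sp = coeff_sparse[OF \<beta> i m f]
  have fP: "f \<in> carrier P" by (rule sp(1))
  have co: "up_ring.coeff P f (c * i) = \<beta> c" if "c * i < n" for c
    using sp(2)[OF that] \<beta>0 by simp
  show "i < n \<Longrightarrow> cf (tp f) i = \<beta> 1" using fP co[of 1] by simp
  have V: "tp f \<in> V i"
  proof -
    have "up_ring.coeff P f d = (if d = 0 then \<one> else \<zero>)" if "d < n" "d < i" for d
      using that co[of 0] \<beta>0 sp(3)[of d] nat_dvd_not_less[of d i] by auto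
    then show ?thesis using fP by (simp add: V_def)
  qed
  have "tp f \<otimes>\<^bsub>A\<^esub> star (tp f) = \<one>\<^bsub>A\<^esub>"
  proof (rule A_eqI)
    fix d assume d: "d < n"
    let ?g = "\<lambda>a. up_ring.coeff P f a \<otimes> sg (d - a) (\<sigma> (up_ring.coeff P f (d - a)))"
    have gc: "?g a \<in> carrier R" for a using fP by simp
    have e: "cf (tp f \<otimes>\<^bsub>A\<^esub> star (tp f)) d = (\<Oplus>a\<in>{..d}. ?g a)"
      using fP d by (simp add: star_tp coeff_poly_star tp_mult)
    have z: "?g a = \<zero>" if "a \<le> d" "\<not> (i dvd a \<and> i dvd d)" for a
    proof (cases "i dvd a")
      \<comment> \<open>Here \<open>i\<close> divides \<open>a\<close> but not \<open>d\<close>, so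
        it does not divide \<open>d - a\<close> and the second factor vanishes.\<close>
      case True
      then have "\<not> i dvd d - a" using that by (metis dvd_diffD)
      then show ?thesis using sp(3) fP by (simp add: sg_def)
    next
      case False
      then show ?thesis using sp(3) fP by simp
    qed
    show "cf (tp f \<otimes>\<^bsub>A\<^esub> star (tp f)) d = cf \<one>\<^bsub>A\<^esub> d"
    proof (cases "i dvd d")
      case False
      then have "d \<noteq> 0" by (metis dvd_0_right)
      moreover have "(\<Oplus>a\<in>{..d}. ?g a) = \<zero>" using z False by (intro R.add.finprod_one_eqI) auto
      ultimately show ?thesis using e d by (simp add: cf_one)
    next
      case True
      then obtain c where c: "d = c * i" by (metis dvd_div_mult_self)
      \<comment> \<open>\<open>finsum_multiples\<close> asks about all indices; the guard settles
        those beyond \<open>d\<close>, about which \<open>z\<close> says nothing.\<close>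
      have "(\<Oplus>a\<in>{..d}. ?g a) = (\<Oplus>a\<in>{..c * i}. if a \<le> d then ?g a else \<zero>)"
        using gc c by (intro R.finsum_cong') auto
      also have "\<dots> = (\<Oplus>s\<in>{..c}. if s * i \<le> d then ?g (s * i) else \<zero>)"
        using gc z i by (intro finsum_multiples) auto
      also have "\<dots> = (\<Oplus>s\<in>{..c}. \<beta> s \<otimes> sg ((c - s) * i) (\<sigma> (\<beta> (c - s))))"
      proof (rule R.finsum_cong')
        fix s assume s: "s \<in> {..c}"
        have "s * i \<le> c * i" using s by simp
        moreover have ds: "d - s * i = (c - s) * i" unfolding c by (simp add: diff_mult_distrib)
        moreover have "(c - s) * i < n" using d ds by linarith
        moreover have "s * i < n" using d c \<open>s * i \<le> c * i\<close> by linarith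
        ultimately show "(if s * i \<le> d then ?g (s * i) else \<zero>) = \<beta> s \<otimes> sg ((c - s) * i) (\<sigma> (\<beta> (c - s)))"
          using c co by simp
      qed (use \<beta> in auto)
      also have "\<dots> = (if c = 0 then \<one> else \<zero>)"
        using conv[of c] \<beta>0 by (cases "c = 0") (auto simp: sg_def)
      finally show ?thesis using e d c i by (auto simp: cf_one)
    qed
  qed (use fP in auto)
  then have "tp f \<in> carrier U" using fP by (simp add: mem_U_iff)
  then show "tp f \<in> W i" using V by (simp add: W_def)
qed

end

context quad_ext
begin

text \<open>This is the identity \<open>B(y) B(-y) = 1\<close> for the power series \<open>B\<close>
  with coefficients \<beta>, where \<beta> supplies the constant term 1 because
  \<open>\<alpha> 0\<close> is unconstrained. Odd degrees cancel by symmetry, degree 2 is the choice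
  of \<open>\<alpha> 2\<close>, and even degrees from 4 on are the recursion.\<close>

lemma alpha_convolution:
  assumes \<alpha>: "alpha_seq R k a \<alpha>" and c: "c \<ge> (1::nat)"
  defines "\<beta> \<equiv> (\<lambda>j. if j = 0 then \<one> else \<alpha> j)"
  shows "(\<Oplus>s\<in>{..c}. \<beta> s \<otimes> (if even (c - s) then \<beta> (c - s) else \<ominus> \<beta> (c - s))) = \<zero>"
    (is "(\<Oplus>s\<in>{..c}. ?h s) = \<zero>")
proof -
  have \<alpha>k: "\<alpha> j \<in> carrier R" if "j \<ge> 1" for j
    using \<alpha> that unfolding alpha_seq_def by simp
  have \<beta>: "\<beta> j \<in> carrier R" for j using \<alpha>k by (simp add: \<beta>_def)
  have hc: "?h s \<in> carrier R" for s using \<beta> by simp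
  show ?thesis
  proof (cases "odd c")
    case True
    have S: "(\<Oplus>s\<in>{..c}. ?h s) \<in> carrier R" by (rule finsum_closed, rule funcsetI, rule hc)
    have "(\<lambda>s. c - s) ` {..c} = {..c}"
    proof
      show "{..c} \<subseteq> (\<lambda>s. c - s) ` {..c}"
      proof
        fix x assume "x \<in> {..c}"
        then show "x \<in> (\<lambda>s. c - s) ` {..c}" by (intro image_eqI[of _ _ "c - x"]) auto
      qed
    qed auto
    then have "(\<Oplus>s\<in>{..c}. ?h s) = (\<Oplus>s\<in>(\<lambda>s. c - s) ` {..c}. ?h s)" by simp
    also have "\<dots> = (\<Oplus>s\<in>{..c}. ?h (c - s))"
      using hc by (intro finsum_reindex) (auto simp: inj_on_def)
    finally have e: "(\<Oplus>s\<in>{..c}. ?h s) = (\<Oplus>s\<in>{..c}. ?h (c - s))" .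
    \<comment> \<open>For odd \<open>c\<close> exactly one of \<open>s\<close> and
      \<open>c - s\<close> is odd, so terms \<open>s\<close> and \<open>c - s\<close> cancel. Since
      the sum equals its reversal, twice the sum is \<zero>.\<close>
    have "(\<Oplus>s\<in>{..c}. ?h s) \<oplus> (\<Oplus>s\<in>{..c}. ?h (c - s)) = (\<Oplus>s\<in>{..c}. ?h s \<oplus> ?h (c - s))"
      by (rule finsum_addf[symmetric]) (rule funcsetI, rule hc)+
    also have "\<dots> = \<zero>"
    proof (rule add.finprod_one_eqI)
      fix s assume s: "s \<in> {..c}"
      then have "even (c - s) \<longleftrightarrow> odd s" using True by auto
      then show "?h s \<oplus> ?h (c - s) = \<zero>"
        using s \<beta>[of s] \<beta>[of "c - s"] by (auto simp: m_comm r_minus l_minus l_neg r_neg)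
    qed
    finally show ?thesis using double_zero[OF S] e by metis
  next
    case False
    then obtain d where d: "c = d * 2" "d \<ge> 1" using c by (auto elim!: evenE)
    show ?thesis
    proof (cases "d = 1")
      case True
      have c2: "c = 2" using True d by simp
      have a: "\<alpha> 1 \<in> carrier R" "\<alpha> 2 \<in> carrier R" using \<alpha>k by auto
      let ?t = "\<one> \<oplus> \<one>"
      have t: "inv ?t \<in> carrier R" "?t \<otimes> inv ?t = \<one>" using two field_Units by auto
      have "\<alpha> 2 = inv ?t \<otimes> \<alpha> 1 [^] (2::nat)" using \<alpha> by (simp add: alpha_seq_def)
      then have "?t \<otimes> \<alpha> 2 = \<alpha> 1 [^] (2::nat)"
        using t a by (simp add: m_assoc[symmetric])
      then have "\<alpha> 2 \<oplus> \<alpha> 2 = \<alpha> 1 \<otimes> \<alpha> 1" using a by (simp add: l_distr numeral_2_eq_2)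
      moreover have "(\<Oplus>s\<in>{..c}. ?h s) = \<alpha> 2 \<oplus> (\<ominus> (\<alpha> 1 \<otimes> \<alpha> 1) \<oplus> \<alpha> 2)"
        using a unfolding c2 by (simp add: atMost_Suc numeral_2_eq_2 \<beta>_def r_minus)
      moreover have "\<alpha> 2 \<oplus> (\<ominus> (\<alpha> 1 \<otimes> \<alpha> 1) \<oplus> \<alpha> 2) = (\<alpha> 2 \<oplus> \<alpha> 2) \<ominus> \<alpha> 1 \<otimes> \<alpha> 1"
        using a by algebra
      ultimately show ?thesis using a by simp
    next
      case False
      then have d2: "d \<ge> 2" using d by simp
      have odd0: "\<alpha> j = \<zero>" if "odd j" "j \<ge> 3" for j
        using \<alpha> that by (simp add: alpha_seq_def)
      \<comment> \<open>As \<open>c \<ge> 4\<close>, for odd \<open>s\<close> one of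
        \<open>s\<close> and \<open>c - s\<close> is an odd index of at least 3, where \<alpha>
        vanishes.\<close>
      have z: "?h s = \<zero>" if "s \<le> c" "odd s" for s
      proof -
        have "odd (c - s)" using that d by auto
        moreover have "s \<ge> 3 \<or> c - s \<ge> 3" using d2 d that by presburger
        ultimately show ?thesis using odd0 that \<beta>[of s] \<beta>[of "c - s"] by (auto simp: \<beta>_def)
      qed
      have "(\<Oplus>s\<in>{..c}. ?h s) = (\<Oplus>s\<in>(\<lambda>r. 2 * r) ` {..d}. ?h s)"
      proof (rule add.finprod_mono_neutral_cong_right)
        fix s assume s: "s \<in> {..c} - (\<lambda>r. 2 * r) ` {..d}"
        then have "odd s" using d by (auto elim!: evenE)
        then show "?h s = \<zero>" using z s by auto
      qed (use d hc in auto)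
      also have "\<dots> = (\<Oplus>r\<in>{..d}. ?h (2 * r))"
        using hc by (intro finsum_reindex) (auto simp: inj_on_def)
      also have "\<dots> = (\<Oplus>r\<in>{..d}. \<beta> (2 * r) \<otimes> \<beta> (c - 2 * r))"
        using \<beta> d by (intro finsum_cong') auto
      \<comment> \<open>The two end terms each contribute \<open>\<alpha> c\<close>; together they
        form the doubled term of the recursion.\<close>
      also have "{..d} = insert 0 (insert d {1..d - 1})" using d2 by auto
      also have "(\<Oplus>r\<in>insert 0 (insert d {1..d - 1}). \<beta> (2 * r) \<otimes> \<beta> (c - 2 * r))
        = \<beta> 0 \<otimes> \<beta> c \<oplus> (\<beta> c \<otimes> \<beta> 0 \<oplus> (\<Oplus>r\<in>{1..d - 1}. \<beta> (2 * r) \<otimes> \<beta> (c - 2 * r)))"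
        using \<beta> d2 d by (subst finsum_insert, simp, simp, simp, simp)
          (subst finsum_insert, auto simp: mult.commute)
      also have "(\<Oplus>r\<in>{1..d - 1}. \<beta> (2 * r) \<otimes> \<beta> (c - 2 * r)) = (\<Oplus>r\<in>{1..d - 1}. \<alpha> (2 * r) \<otimes> \<alpha> (c - 2 * r))"
        using \<alpha>k d by (intro finsum_cong') (auto simp: \<beta>_def)
      also have "\<beta> 0 \<otimes> \<beta> c \<oplus> (\<beta> c \<otimes> \<beta> 0 \<oplus> (\<Oplus>r\<in>{1..d - 1}. \<alpha> (2 * r) \<otimes> \<alpha> (c - 2 * r)))
        = (\<one> \<oplus> \<one>) \<otimes> \<alpha> c \<oplus> (\<Oplus>r\<in>{1..d - 1}. \<alpha> (2 * r) \<otimes> \<alpha> (c - 2 * r))"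
      proof -
        have "(\<Oplus>r\<in>{1..d - 1}. \<alpha> (2 * r) \<otimes> \<alpha> (c - 2 * r)) \<in> carrier R"
          using \<alpha>k d by (intro finsum_closed) auto
        then show ?thesis using \<alpha>k[of c] c by (simp add: \<beta>_def l_distr a_assoc)
      qed
      also have "\<dots> = \<zero>"
      proof -
        have "c \<ge> 4" "even c" "c div 2 = d" using d d2 by auto
        then show ?thesis using \<alpha> unfolding alpha_seq_def by auto
      qed
      finally show ?thesis .
    qed
  qed
qed

end

section \<open>The decomposition\<close>

locale unitary_decomp = R?: quad_ext R k \<Delta> p t q e + UP R P
  for R (structure) and P (structure) and k \<Delta> p t q e +
  fixes n :: nat and \<alpha> :: "nat \<Rightarrow> nat \<Rightarrow> 'a"
  assumes n_ge_1: "n \<ge> 1"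
    and alpha: "\<And>l. l \<in> {1..t} \<Longrightarrow> alpha_seq R k (e l) (\<alpha> l)"
begin

sublocale T?: trunc_unitary R P n k \<Delta>
  by unfold_locales (use n_ge_1 in \<open>simp_all add: P_def conj_hom conj_conj\<close>)

lemma minus_pow:
  assumes "x \<in> carrier R"
  shows "(\<ominus> x) [^] (u::nat) = (if even u then x [^] u else \<ominus> (x [^] u))"
  by (induction u) (use assms in \<open>auto simp: R.l_minus R.r_minus\<close>)

definition z :: "nat \<Rightarrow> nat \<Rightarrow> (nat \<Rightarrow> 'a) set" where "z l i = z_gen R \<Delta> n (\<alpha> l) i"

text \<open>The generator is \<open>B(y)\<close> at \<open>y = \<delta> i x^i\<close>, and the
  involution sends this \<open>y\<close> to \<open>-y\<close>; hence
  \<open>alpha_convolution\<close> supplies the hypothesis \<open>conv\<close> of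
  \<open>sparse_in_W\<close>.\<close>

lemma z_in_W:
  assumes l: "l \<in> {1..t}" and i: "i \<ge> 1"
  shows "z l i \<in> W i" "i < n \<Longrightarrow> cf (z l i) i = e l \<otimes> \<delta> i"
proof -
  define m where "m = (THE m. m * i < n \<and> n \<le> (m + 1) * i)"
  have "\<exists>!m. m * i < n \<and> n \<le> (m + 1) * i"
  proof (rule ex_ex1I)
    \<comment> \<open>The witness \<open>(n - 1) div i\<close> counts the positive multiples of
      \<open>i\<close> below \<open>n\<close>.\<close>
    have "(n - 1) div i * i \<le> n - 1" by simp
    moreover have "n - 1 < ((n - 1) div i + 1) * i"
      using i dividend_less_div_times[of i "n - 1"] by simp
    ultimately show "\<exists>m. m * i < n \<and> n \<le> (m + 1) * i"
      using n_ge_1 by (intro exI[of _ "(n - 1) div i"]) linarith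
  next
    fix a b assume a: "a * i < n \<and> n \<le> (a + 1) * i" and b: "b * i < n \<and> n \<le> (b + 1) * i"
    have "a * i < (b + 1) * i" "b * i < (a + 1) * i" using a b by linarith+
    then have "a < b + 1" "b < a + 1" using mult_less_cancel2 by blast+
    then show "a = b" by simp
  qed
  from theI'[OF this] have m: "n \<le> (m + 1) * i" unfolding m_def by blast
  define b where "b j = (if j = 0 then \<one> else \<alpha> l j)" for j :: nat
  define \<beta> where "\<beta> j = b j \<otimes> \<delta> i [^] j" for j
  have \<alpha>k: "\<alpha> l j \<in> k" if "j \<ge> 1" for j
    using alpha[OF l] that unfolding alpha_seq_def by simp
  have bk: "b j \<in> k" for j using \<alpha>k by (simp add: b_def)
  have bR: "b j \<in> carrier R" for j by (rule k_sub[OF bk])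
  have \<beta>R: "\<beta> j \<in> carrier R" for j using bR by (simp add: \<beta>_def)
  define f where "f = \<one>\<^bsub>P\<^esub> \<oplus>\<^bsub>P\<^esub> (\<Oplus>\<^bsub>P\<^esub>j\<in>{1..m}. up_ring.monom P (\<beta> j) (j * i))"
  have eq: "(\<Oplus>\<^bsub>P\<^esub>j\<in>{1..m}. up_ring.monom P (if odd i then \<alpha> l j else \<alpha> l j \<otimes> \<Delta> [^] j) (j * i))
      = (\<Oplus>\<^bsub>P\<^esub>j\<in>{1..m}. up_ring.monom P (\<beta> j) (j * i))"
  proof (rule P.finsum_cong')
    fix j assume j: "j \<in> {1..m}"
    then have "\<alpha> l j \<in> carrier R" using \<alpha>k by simp
    then have "(if odd i then \<alpha> l j else \<alpha> l j \<otimes> \<Delta> [^] j) = \<beta> j"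
      using j by (simp add: \<beta>_def b_def \<delta>_def)
    then show "up_ring.monom P (if odd i then \<alpha> l j else \<alpha> l j \<otimes> \<Delta> [^] j) (j * i)
        = up_ring.monom P (\<beta> j) (j * i)" by (rule arg_cong)
  qed (use \<beta>R in auto)
  have z: "z l i = tp f"
    unfolding z_def z_gen_def Let_def m_def[symmetric] P_def[symmetric] eq f_def tp_def ..
  have conv: "(\<Oplus>s\<in>{..c}. \<beta> s \<otimes> sg ((c - s) * i) (\<sigma> (\<beta> (c - s)))) = \<zero>" if c: "c \<ge> 1" for c
  proof -
    let ?h = "\<lambda>s. b s \<otimes> (if even (c - s) then b (c - s) else \<ominus> b (c - s))"
    \<comment> \<open>In both parities the total sign is that of \<open>u\<close>: for odd
      \<open>i\<close> it comes from the degree \<open>u * i\<close>, for even \<open>i\<close> from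
      conjugating the power of \<Delta>.\<close>
    have conj: "sg (u * i) (\<sigma> (\<beta> u)) = (if even u then b u else \<ominus> b u) \<otimes> \<delta> i [^] u" for u
    proof -
      have "\<sigma> (\<beta> u) = b u \<otimes> \<sigma> (\<delta> i) [^] u"
        unfolding \<beta>_def using bR by (simp add: conj_k[OF bk] S.hom_pow)
      moreover have "\<sigma> (\<delta> i) = (if odd i then \<delta> i else \<ominus> \<delta> i)"
        by (simp add: \<delta>_def conj_\<Delta>)
      ultimately show ?thesis
        using bR[of u] by (auto simp: sg_def minus_pow R.l_minus R.r_minus)
    qed
    have "(\<Oplus>s\<in>{..c}. \<beta> s \<otimes> sg ((c - s) * i) (\<sigma> (\<beta> (c - s)))) = (\<Oplus>s\<in>{..c}. \<delta> i [^] c \<otimes> ?h s)"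
    proof (rule R.finsum_cong')
      fix s assume s: "s \<in> {..c}"
      then have "\<delta> i [^] c = \<delta> i [^] s \<otimes> \<delta> i [^] (c - s)" by (simp add: R.nat_pow_mult)
      then show "\<beta> s \<otimes> sg ((c - s) * i) (\<sigma> (\<beta> (c - s))) = \<delta> i [^] c \<otimes> ?h s"
        unfolding conj unfolding \<beta>_def using bR by (simp add: R.m_ac)
    qed (use bR in auto)
    also have "\<dots> = \<delta> i [^] c \<otimes> (\<Oplus>s\<in>{..c}. ?h s)"
      using bR by (intro R.finsum_rdistr[symmetric]) auto
    also have "(\<Oplus>s\<in>{..c}. ?h s) = \<zero>"
      using alpha_convolution[OF alpha[OF l] c] unfolding b_def .
    finally show ?thesis by simp
  qed
  have \<beta>0: "\<beta> 0 = \<one>" by (simp add: \<beta>_def b_def)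
  note sp = sparse_in_W[OF \<beta>R \<beta>0 i m f_def conv]
  show "z l i \<in> W i" unfolding z by (rule sp(1))
  have "\<alpha> l 1 = e l" using alpha[OF l] by (simp add: alpha_seq_def)
  then have "\<beta> 1 = e l \<otimes> \<delta> i" by (simp add: \<beta>_def b_def)
  then show "i < n \<Longrightarrow> cf (z l i) i = e l \<otimes> \<delta> i" unfolding z using sp(2) by simp
qed

section \<open>Leading coefficients of powers of the generators\<close>

lemma W_D: "a \<in> W j \<Longrightarrow> a \<in> V j" "a \<in> W j \<Longrightarrow> a \<in> carrier U" "a \<in> W j \<Longrightarrow> a \<in> carrier A"
  using V_closed by (auto simp: W_def)

text \<open>The factor \<open>p ^ r\<close> of the exponent raises the depth by Frobenius; the
  factor \<open>m\<close> then acts additively on the leading coefficient.\<close>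

lemma z_pow:
  assumes l: "l \<in> {1..t}" and i: "i \<ge> 1"
  shows "z l i [^]\<^bsub>U\<^esub> (p ^ r * m) \<in> W (i * p ^ r)"
    "i * p ^ r < n \<Longrightarrow>
      cf (z l i [^]\<^bsub>U\<^esub> (p ^ r * m)) (i * p ^ r) = add_pow R m ((e l \<otimes> \<delta> i) [^] (p ^ r))"
proof -
  have zW: "z l i \<in> W i" by (rule z_in_W[OF assms])
  note V = V_pow_prime_power[OF W_D(1)[OF zW] i p char, of r]
  have j: "i * p ^ r \<ge> 1" using i prime_gt_0_nat[OF p] by simp
  have e: "z l i [^]\<^bsub>U\<^esub> (p ^ r * m) = (z l i [^]\<^bsub>A\<^esub> (p ^ r)) [^]\<^bsub>A\<^esub> m"
    using W_D(3)[OF zW] by (simp add: U_pow A.nat_pow_pow)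
  show "z l i [^]\<^bsub>U\<^esub> (p ^ r * m) \<in> W (i * p ^ r)"
    using V_pow(1)[OF V(1) j, of m] W_D(2)[OF zW] unfolding W_def e[symmetric] by simp
  assume l: "i * p ^ r < n"
  moreover have "i * 1 \<le> i * p ^ r" using prime_gt_0_nat[OF p] by (intro mult_le_mono2) simp
  ultimately have "i < n" by linarith
  then show "cf (z l i [^]\<^bsub>U\<^esub> (p ^ r * m)) (i * p ^ r) = add_pow R m ((e l \<otimes> \<delta> i) [^] (p ^ r))"
    unfolding e using V_pow(2)[OF V(1) j l] V(2)[OF l] z_in_W(2)[OF assms] by simp
qed

lemma z_U: "l \<in> {1..t} \<Longrightarrow> i \<ge> 1 \<Longrightarrow> z l i \<in> carrier U"
  using z_in_W W_D by blast

text \<open>Since \<open>p ^ n \<ge> n\<close>, the power with exponent \<open>p ^ n\<close> lies in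
  the trivial step of the filtration. So the generator has finite order and natural exponents
  suffice.\<close>

lemma z_generate:
  assumes l: "l \<in> {1..t}" and i: "i \<ge> 1"
  shows "generate U {z l i} = {z l i [^]\<^bsub>U\<^esub> m | m :: nat. True}"
proof -
  have "n \<le> p ^ n" using power_gt_expt[of p n] prime_ge_2_nat[OF p] by simp
  also have "p ^ n \<le> i * p ^ n" using i by simp
  finally have "z l i [^]\<^bsub>U\<^esub> (p ^ n) = \<one>\<^bsub>A\<^esub>"
    using z_pow(1)[OF assms, of n 1] V_ge_n by (auto simp: W_def)
  then have "U.ord (z l i) \<noteq> 0"
    using U.ord_eq_0[OF z_U[OF assms]] prime_gt_0_nat[OF p] by auto
  from U.generate_pow_nat[OF z_U[OF assms] this] show ?thesis by simp
qed

lemma H_eq: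
  assumes l: "l \<in> {1..t}" and i: "i \<ge> 1"
  shows "H_subgroup R k \<Delta> n (\<alpha> l) i = generate U {z l i}"
proof -
  have "z l i \<in> W 1" using z_in_W(1)[OF assms] V_antimono[OF i] by (auto simp: W_def)
  then show ?thesis unfolding H_subgroup_def z_def by (rule generate_unitary_group0)
qed

lemma p_decomp:
  assumes "j \<ge> 1"
  obtains i r where "j = i * p ^ r" "coprime i p" "i \<ge> 1"
proof -
  obtain i where i: "j = p ^ multiplicity p j * i" "\<not> p dvd i"
    using multiplicity_decompose'[of j p] assms p by (metis not_one_le_zero not_prime_unit)
  moreover have "coprime i p" using i p by (metis coprime_commute prime_imp_coprime)
  moreover have "i \<ge> 1" using i(2) by (cases i) auto
  ultimately show ?thesis using that[of i "multiplicity p j"] by (simp add: mult.commute)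
qed

lemma p_decomp_unique:
  assumes eq: "i * p ^ r = i' * p ^ r'" and c: "coprime i p" "coprime i' p"
  shows "i = i'" "r = r'"
proof -
  have nd: "\<not> p dvd i" "\<not> p dvd i'"
    using c p by (auto simp: coprime_absorb_right dest: not_prime_unit)
  have "multiplicity p (x * p ^ s) = s" if "\<not> p dvd x" for x s
    using that p by (intro multiplicity_eqI) (auto simp: mult.commute)
  then show r: "r = r'" using eq nd by metis
  then show "i = i'" using eq prime_gt_0_nat[OF p] by simp
qed

text \<open>A positive exponent is \<open>c * p ^ r\<close> with \<open>c\<close> prime to
  \<open>p\<close>, so the power has a first nonzero coefficient in degree \<open>i * p ^ r\<close>,
  provided this is below \<open>n\<close>. Membership in \<open>W j\<close> rules out that this
  degree is smaller than \<open>j\<close>.\<close>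

lemma z_pow_lead:
  assumes l: "l \<in> {1..t}" and i: "i \<ge> 1" and j: "j \<ge> 1" "j < n"
    and zm: "z l i [^]\<^bsub>U\<^esub> (m::nat) \<in> W j"
  shows "cf (z l i [^]\<^bsub>U\<^esub> m) j = \<zero> \<or>
    (\<exists>r c. j = i * p ^ r \<and> cf (z l i [^]\<^bsub>U\<^esub> m) j = add_pow R (c::nat) ((e l \<otimes> \<delta> i) [^] (p ^ r)))"
proof (cases "m = 0")
  case True
  then show ?thesis using j by (simp add: cf_one)
next
  case False
  then have "m \<ge> 1" by simp
  from p_decomp[OF this] obtain c r where m: "m = c * p ^ r" "coprime c p" by metis
  have m': "m = p ^ r * c" using m by (simp add: mult.commute)
  note zp = z_pow[OF l i, of r c, folded m']
  have jr: "i * p ^ r \<ge> 1" using i prime_gt_0_nat[OF p] by simp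
  consider "j < i * p ^ r" | "j = i * p ^ r" | "j > i * p ^ r" by linarith
  then show ?thesis
  proof cases
    case 1
    then show ?thesis using zp(1) j by (auto simp: W_def V_def)
  next
    case 2
    then show ?thesis using zp(2) j by blast
  next
    \<comment> \<open>Contradictory: \<open>W j\<close> forces the coefficient in degree
      \<open>i * p ^ r\<close> to vanish, but neither \<open>c\<close> nor the base of the power is
      zero in the field.\<close>
    case 3
    let ?b = "e l \<otimes> \<delta> i"
    have bR: "?b \<in> carrier R" using e_carrier[OF l] by simp
    have "\<forall>i'<n. i' < j \<longrightarrow> cf (z l i [^]\<^bsub>U\<^esub> m) i' = (if i' = 0 then \<one> else \<zero>)"
      using W_D(1)[OF zm] unfolding V_def by blast
    moreover have "i * p ^ r \<noteq> 0" "i * p ^ r < n" using jr 3 j by linarith+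
    ultimately have "cf (z l i [^]\<^bsub>U\<^esub> m) (i * p ^ r) = \<zero>" "i * p ^ r < n"
      using 3 by presburger+
    then have "add_pow R c (?b [^] (p ^ r)) = \<zero>"
      using zp(2) by (simp only:)
    then have "add_pow R c \<one> \<otimes> ?b [^] (p ^ r) = \<zero>"
      using R.add_pow_eq_mult[of "?b [^] (p ^ r)" c] bR by (simp only: R.nat_pow_closed)
    moreover have "add_pow R c \<one> \<noteq> \<zero>"
      using m(2) p by (auto simp: char_iff coprime_absorb_right dest: not_prime_unit)
    moreover have "?b \<noteq> \<zero>"
    proof
      assume "?b = \<zero>"
      then have el: "e l = \<zero>" using e_carrier[OF l] \<delta>_nz R.integral[of "e l" "\<delta> i"] by auto
      \<comment> \<open>A vanishing \<open>e l\<close> would give a relation whose only nonzero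
        coefficient is a 1 at \<open>l\<close>.\<close>
      have "(\<Oplus>l'\<in>{1..t}. add_pow R (if l' = l then 1 else 0 :: nat) (e l')) = \<zero>"
        using el e_carrier by (intro R.add.finprod_one_eqI) auto
      then have "add_pow R (1::nat) \<one> = \<zero>"
        using basis_indep[of "\<lambda>l'. if l' = l then 1 else 0" l] l by simp
      then show False by simp
    qed
    ultimately show ?thesis using bR R.integral R.pow_nonzero by (metis R.nat_pow_closed R.add.nat_pow_closed R.one_closed)
  qed
qed

section \<open>Independence of the generators, generation, and assembly\<close>

definition I where "I = {i. 1 \<le> i \<and> i \<le> n - 1 \<and> coprime i p}"

lemma finite_I: "finite I"
  by (rule finite_subset[of _ "{..n}"]) (auto simp: I_def)

lemma I_D: "i \<in> I \<Longrightarrow> i \<ge> 1" "i \<in> I \<Longrightarrow> coprime i p" "i \<in> I \<Longrightarrow> i < n"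
  using n_ge_1 by (auto simp: I_def)

text \<open>The induction shows that every factor, not just the product, lies in \<open>W j\<close>;
  at \<open>j = n\<close> this makes every factor trivial. The step uses that in degree
  \<open>j\<close> only one index \<open>i\<close> can contribute, and there
  \<open>twisted_indep\<close> applies.\<close>

lemma z_indep:
  assumes h: "\<And>i l. i \<in> I \<Longrightarrow> l \<in> {1..t} \<Longrightarrow> h (i, l) \<in> generate U {z l i}"
    and one: "finprod U h (I \<times> {1..t}) = \<one>\<^bsub>A\<^esub>"
    and x: "i \<in> I" "l \<in> {1..t}"
  shows "h (i, l) = \<one>\<^bsub>A\<^esub>"
proof -
  let ?J = "I \<times> {1..t}"
  have hz: "\<exists>m::nat. h (i, l) = z l i [^]\<^bsub>U\<^esub> m" if "i \<in> I" "l \<in> {1..t}" for i l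
    using h[OF that] z_generate[OF that(2) I_D(1)[OF that(1)]] by auto
  have "1 \<le> j \<longrightarrow> j \<le> n \<longrightarrow> (\<forall>x\<in>?J. h x \<in> W j)" for j
  proof (induction j)
    case (Suc j)
    show ?case
    proof (cases "j = 0")
      \<comment> \<open>The claim is guarded by \<open>1 \<le> j\<close>, so the real base case is
        \<open>W 1\<close>, which contains all the generators.\<close>
      case True
      have "h (i, l) \<in> W 1" if il: "i \<in> I" "l \<in> {1..t}" for i l
      proof -
        obtain m :: nat where m: "h (i, l) = z l i [^]\<^bsub>U\<^esub> m" using hz[OF il] by auto
        have "h (i, l) \<in> W i"
          unfolding m using z_pow(1)[OF il(2) I_D(1)[OF il(1)], of 0 m] by simp
        then show ?thesis using V_antimono[OF I_D(1)[OF il(1)]] by (auto simp: W_def)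
      qed
      then show ?thesis using True by auto
    next
      case False
      show ?thesis
      proof (intro impI)
        assume "Suc j \<le> n"
        then have j: "1 \<le> j" "j < n" and W: "\<forall>x\<in>?J. h x \<in> W j" using False Suc by auto
        obtain i0 r where ir: "j = i0 * p ^ r" "coprime i0 p" "i0 \<ge> 1" using p_decomp[OF j(1)] .
        have hR: "cf (h x) j \<in> carrier R" if "x \<in> ?J" for x
          using W that W_D(3) j(2) cf_closed by blast
        have sum: "(\<Oplus>x\<in>?J. cf (h x) j) = \<zero>"
          using W_finprod(2)[OF j(1), of h ?J] W finite_I one j by (simp add: cf_one Pi_iff)
        have lead: "cf (h (i, l)) j = \<zero> \<or>
            (i = i0 \<and> (\<exists>c::nat. cf (h (i, l)) j = add_pow R c ((e l \<otimes> \<delta> i) [^] (p ^ r))))"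
          if il: "i \<in> I" "l \<in> {1..t}" for i l
        proof -
          obtain m :: nat where m: "h (i, l) = z l i [^]\<^bsub>U\<^esub> m" using hz[OF il] by auto
          have "z l i [^]\<^bsub>U\<^esub> m \<in> W j" using W il m by (metis SigmaI)
          from z_pow_lead[OF il(2) I_D(1)[OF il(1)] j this]
          show ?thesis unfolding m
          proof
            assume "\<exists>r' c. j = i * p ^ r' \<and>
              cf (z l i [^]\<^bsub>U\<^esub> m) j = add_pow R (c::nat) ((e l \<otimes> \<delta> i) [^] (p ^ r'))"
            then obtain r' c where c: "j = i * p ^ r'"
              "cf (z l i [^]\<^bsub>U\<^esub> m) j = add_pow R (c::nat) ((e l \<otimes> \<delta> i) [^] (p ^ r'))" by blast
            have "i = i0" "r' = r" using p_decomp_unique c(1) ir I_D(2)[OF il(1)] by metis+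
            then show "cf (z l i [^]\<^bsub>U\<^esub> m) j = \<zero> \<or> i = i0 \<and>
              (\<exists>c::nat. cf (z l i [^]\<^bsub>U\<^esub> m) j = add_pow R c ((e l \<otimes> \<delta> i) [^] (p ^ r)))"
              using c by blast
          qed blast
        qed
        have zero: "cf (h (i, l)) j = \<zero>" if il: "i \<in> I" "l \<in> {1..t}" for i l
        proof (cases "i = i0")
          case False
          then show ?thesis using lead[OF il] by blast
        next
          case True
          then have i0: "i0 \<in> I" using il by simp
          have "\<exists>c::nat. cf (h (i0, l)) j = add_pow R c ((e l \<otimes> \<delta> i0) [^] (p ^ r))"
            if l: "l \<in> {1..t}" for l
          proof -
            consider "cf (h (i0, l)) j = \<zero>"
              | c where "cf (h (i0, l)) j = add_pow R (c::nat) ((e l \<otimes> \<delta> i0) [^] (p ^ r))"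
              using lead[OF i0 l] by blast
            then show ?thesis
            proof cases
              case 1
              then show ?thesis by (intro exI[of _ 0]) simp
            qed blast
          qed
          then obtain c :: "nat \<Rightarrow> nat" where
            c: "\<And>l. l \<in> {1..t} \<Longrightarrow> cf (h (i0, l)) j = add_pow R (c l) ((e l \<otimes> \<delta> i0) [^] (p ^ r))"
            by metis
          \<comment> \<open>By \<open>lead\<close>, all pairs whose first entry is not
            \<open>i0\<close> contribute \<zero>.\<close>
          have "(\<Oplus>x\<in>?J. cf (h x) j) = (\<Oplus>x\<in>Pair i0 ` {1..t}. cf (h x) j)"
          proof (rule R.add.finprod_mono_neutral_cong_right)
            fix x assume "x \<in> ?J - Pair i0 ` {1..t}"
            moreover obtain i l where "x = (i, l)" by (cases x)
            ultimately have "x = (i, l)" "i \<in> I" "l \<in> {1..t}" "i \<noteq> i0" by auto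
            then show "cf (h x) j = \<zero>" using lead by blast
          qed (use i0 finite_I hR in auto)
          also have "\<dots> = (\<Oplus>l\<in>{1..t}. cf (h (i0, l)) j)"
            using hR i0 by (intro R.finsum_reindex) (auto simp: inj_on_def)
          also have "\<dots> = (\<Oplus>l\<in>{1..t}. add_pow R (c l) ((e l \<otimes> \<delta> i0) [^] (p ^ r)))"
            using c e_carrier by (intro R.finsum_cong') auto
          finally have "(\<Oplus>l\<in>{1..t}. add_pow R (c l) ((e l \<otimes> \<delta> i0) [^] (p ^ r))) = \<zero>"
            using sum by simp
          from twisted_indep[OF \<delta>_closed \<delta>_nz this il(2)]
          have "add_pow R (c l) \<one> = \<zero>" .
          then show ?thesis
            using c[OF il(2)] True e_carrier[OF il(2)]
              R.add_pow_ldistr[of \<one> "(e l \<otimes> \<delta> i) [^] (p ^ r)" "c l"] by simp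
        qed
        have "h (i, l) \<in> W (Suc j)" if "i \<in> I" "l \<in> {1..t}" for i l
          using W that zero[OF that] V_Suc_iff[OF j] unfolding W_def by blast
        then show "\<forall>x\<in>?J. h x \<in> W (Suc j)" by auto
      qed
    qed
  qed simp
  then have "h (i, l) \<in> W n" using x n_ge_1 by auto
  then show ?thesis using V_ge_n by (auto simp: W_def)
qed

text \<open>Descending induction from the trivial \<open>W n\<close>. An arbitrary subgroup
  \<open>T\<close> containing the generators is allowed, so that it can later be the one generated
  by all the factors.\<close>

lemma W_generated:
  assumes T: "subgroup T U" and zT: "\<And>i l. i \<in> I \<Longrightarrow> l \<in> {1..t} \<Longrightarrow> z l i \<in> T"
    and j: "j \<le> n"
  shows "1 \<le> j \<Longrightarrow> W j \<subseteq> T"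
  using j
proof (induction j rule: inc_induct)
  case base
  show ?case using V_ge_n subgroup.one_closed[OF T] by (auto simp: W_def)
next
  case (step j)
  show ?case
  proof
    fix a assume a: "a \<in> W j"
    obtain i r where ir: "j = i * p ^ r" "coprime i p" "i \<ge> 1" using p_decomp step by metis
    have "i * 1 \<le> i * p ^ r" using prime_gt_0_nat[OF p] by (intro mult_le_mono2) simp
    then have "i \<le> n - 1" using ir(1) step by linarith
    then have iI: "i \<in> I" using ir by (simp add: I_def)
    have aR: "cf a j \<in> carrier R" using a W_D(3) step by simp
    have "sg j (\<sigma> (cf a j)) = \<ominus> cf a j" using W_lead[OF a] step by simp
    then have "(if even (i * p ^ r) then \<sigma> (cf a j) else \<ominus> \<sigma> (cf a j)) = \<ominus> cf a j"
      by (simp only: sg_def ir(1)[symmetric])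
    from lead_coeff[OF aR this] obtain s where s: "s \<in> k" "cf a j = s \<otimes> \<delta> i [^] (p ^ r)" by blast
    obtain m :: "nat \<Rightarrow> nat" where
      m: "cf a j = (\<Oplus>l\<in>{1..t}. add_pow R (m l) ((e l \<otimes> \<delta> i) [^] (p ^ r)))"
      using twisted_span[OF \<delta>_closed s(1), of i r] s(2) by metis
    \<comment> \<open>Exponents chosen so that the product of the \<open>g l\<close> has the same
      leading coefficient as \<open>a\<close>, by \<open>z_pow\<close> and the expansion
      \<open>m\<close>.\<close>
    define g where "g l = z l i [^]\<^bsub>U\<^esub> (p ^ r * m l)" for l
    have gW: "g \<in> {1..t} \<rightarrow> W j" using z_pow(1) ir by (auto simp: g_def)
    let ?h = "finprod U g {1..t}"
    have hW: "?h \<in> W j" using W_finprod(1)[OF _ gW] step by simp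
    have "cf ?h j = (\<Oplus>l\<in>{1..t}. cf (g l) j)"
      using W_finprod(2)[OF _ gW] step by simp
    also have "\<dots> = cf a j"
      unfolding m using z_pow(2)[of _ i r] ir step e_carrier
      by (intro R.finsum_cong') (auto simp: g_def)
    finally have hc: "cf ?h j = cf a j" .
    have pow_T: "b [^]\<^bsub>U\<^esub> (u::nat) \<in> T" if "b \<in> T" for b u
      by (induction u) (use that subgroup.one_closed[OF T] subgroup.m_closed[OF T] in auto)
    have gT: "g l \<in> T" if "l \<in> {1..t}" for l
      unfolding g_def using pow_T zT iI that by blast
    have prod_T: "finprod U g L \<in> T" if "L \<subseteq> {1..t}" for L
      using finite_subset[OF that finite_atLeastAtMost] that
    proof (induction L rule: finite_induct)
      case (insert l L)
      have "finprod U g (insert l L) = g l \<otimes>\<^bsub>A\<^esub> finprod U g L"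
        using insert gT subgroup.mem_carrier[OF T] by (intro U.finprod_insert) auto
      then show ?case using insert gT subgroup.m_closed[OF T, of "g l" "finprod U g L"] by auto
    qed (use subgroup.one_closed[OF T] in auto)
    have hT: "?h \<in> T" by (rule prod_T) simp
    let ?b = "inv\<^bsub>U\<^esub> ?h \<otimes>\<^bsub>A\<^esub> a"
    have j1: "1 \<le> j" "j < n" using step by auto
    have ihW: "inv\<^bsub>U\<^esub> ?h \<in> W j" using subgroup.m_inv_closed[OF W_subgroup[OF j1(1)] hW] by simp
    have bW: "?b \<in> W j" using subgroup.m_closed[OF W_subgroup[OF j1(1)] ihW a] by simp
    \<comment> \<open>The leading coefficients cancel, so the quotient \<open>?b\<close> lies one
      step deeper and the induction hypothesis applies.\<close>
    have "cf ?b j = cf (inv\<^bsub>U\<^esub> ?h) j \<oplus> cf a j"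
      using ihW a j1 by (intro V_mult(2)) (auto simp: W_def)
    also have "\<dots> = \<zero>" using W_inv[OF hW j1] hc aR by (simp add: R.l_neg)
    finally have "?b \<in> W (Suc j)" using bW V_Suc_iff[OF j1] by (auto simp: W_def)
    then have "?b \<in> T" using step by auto
    then have "?h \<otimes>\<^bsub>A\<^esub> ?b \<in> T" using subgroup.m_closed[OF T hT] by simp
    moreover have "?h \<otimes>\<^bsub>A\<^esub> ?b = a"
      using W_D(2)[OF hW] W_D(2)[OF a] by (simp add: U.m_assoc[symmetric])
    ultimately show "a \<in> T" by simp
  qed
qed

text \<open>The index \<open>None\<close> carries the cyclic group of constants of norm one.
  \<open>U_decomp\<close> and \<open>W_generated\<close> give generation. For independence, constant
  terms first force the factor at \<open>None\<close> to be trivial, and then \<open>z_indep\<close>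
  handles the rest.\<close>

lemma decomposition:
  "\<exists>C. subgroup C U \<and> cyclic_group (U\<lparr>carrier := C\<rparr>) \<and> card C = q + 1 \<and>
    internal_direct_product U (insert None (Some ` (I \<times> {1..t})))
      (case_option C (\<lambda>(i, l). H_subgroup R k \<Delta> n (\<alpha> l) i))"
proof -
  obtain c where c: "c \<in> carrier R" "\<And>m. c [^] (m::nat) = \<one> \<longleftrightarrow> (q + 1) dvd m"
    "\<And>x. x \<in> carrier R \<Longrightarrow> x \<otimes> \<sigma> x = \<one> \<longleftrightarrow> (\<exists>m::nat. x = c [^] m)"
    using norm_one_generator by blast
  have "c \<otimes> \<sigma> c = \<one>" using c(3)[OF c(1)] c(1) by (metis R.nat_pow_eone)
  then have cU: "const c \<in> carrier U" using c(1) by (simp add: const_in_U)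
  have pow1: "const c [^]\<^bsub>U\<^esub> m = \<one>\<^bsub>A\<^esub> \<longleftrightarrow> (q + 1) dvd m" for m :: nat
    unfolding U_pow const_pow[OF c(1)] using c(1,2) const_eq_one_iff by simp
  have ord: "U.ord (const c) = q + 1"
    using U.ord_unique[OF cU, of "q + 1"] pow1 by simp
  define C where "C = generate U {const c}"
  have C_eq: "C = {const (c [^] m) | m :: nat. True}"
    unfolding C_def using U.generate_pow_nat[OF cU] ord by (auto simp: U_pow const_pow[OF c(1)])
  have CU: "subgroup C U" unfolding C_def by (rule U.generate_is_subgroup) (simp add: cU)
  have "subgroup_generated U {const c} = U\<lparr>carrier := C\<rparr>"
    unfolding subgroup_generated_def C_def using cU by simp
  then have cyc: "cyclic_group (U\<lparr>carrier := C\<rparr>)"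
    using U.cyclic_group_generated[of "const c"] by simp
  have cardC: "card C = q + 1"
    using U.generate_pow_card[OF cU] ord by (simp add: C_def)
  let ?J = "I \<times> {1..t}"
  let ?H = "case_option C (\<lambda>(i, l). H_subgroup R k \<Delta> n (\<alpha> l) i)"
  have H_Some: "?H (Some (i, l)) = generate U {z l i}" if "i \<in> I" "l \<in> {1..t}" for i l
    using H_eq[OF that(2) I_D(1)[OF that(1)]] by simp
  have sub: "subgroup (?H x) U" if x: "x \<in> insert None (Some ` ?J)" for x
  proof (cases x)
    case (Some y)
    then obtain i l where il: "y = (i, l)" "i \<in> I" "l \<in> {1..t}" using x by auto
    show ?thesis
      unfolding Some il(1) H_Some[OF il(2,3)]
      by (rule U.generate_is_subgroup) (use z_U[OF il(3) I_D(1)[OF il(2)]] in simp)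
  qed (simp add: CU)
  have "internal_direct_product U (insert None (Some ` ?J)) ?H"
  proof (rule U.internal_direct_productI)
    show "finite (insert None (Some ` ?J))" using finite_I by simp
    show "subgroup (?H x) U" if "x \<in> insert None (Some ` ?J)" for x by (rule sub[OF that])
    show "carrier U \<subseteq> generate U (\<Union>x\<in>insert None (Some ` ?J). ?H x)" (is "_ \<subseteq> ?T")
    proof
      have T: "subgroup ?T U"
        by (rule U.generate_is_subgroup) (use sub subgroup.subset in blast)
      have "z l i \<in> ?T" if "i \<in> I" "l \<in> {1..t}" for i l
      proof -
        have "z l i \<in> ?H (Some (i, l))" unfolding H_Some[OF that] by (simp add: generate.incl)
        then show ?thesis using that by (intro generate.incl UN_I[of "Some (i, l)"]) auto
      qed
      then have W1: "W 1 \<subseteq> ?T" using W_generated[OF T _ n_ge_1] by blast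
      fix a assume a: "a \<in> carrier U"
      have a0: "cf a 0 \<in> carrier R" using U_closed[OF a] n_ge_1 by simp
      have "cf a 0 \<otimes> \<sigma> (cf a 0) = \<one>" by (rule U_decomp(1)[OF a])
      then have cc: "const (cf a 0) \<in> carrier U" "const (cf a 0) \<in> C"
        using a0 c(3)[OF a0] by (auto simp: const_in_U C_eq)
      then have "const (cf a 0) \<in> ?T"
        by (intro generate.incl UN_I[of None]) auto
      then have "const (cf a 0) \<otimes>\<^bsub>A\<^esub> (inv\<^bsub>U\<^esub> (const (cf a 0)) \<otimes>\<^bsub>A\<^esub> a) \<in> ?T"
        using subgroup.m_closed[OF T] W1 U_decomp(2)[OF a] by auto
      then show "a \<in> ?T" using cc a by (simp add: U.m_assoc[symmetric])
    qed
    fix h x assume h: "h \<in> Pi (insert None (Some ` ?J)) ?H"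
      and one: "finprod U h (insert None (Some ` ?J)) = \<one>\<^bsub>A\<^esub>"
      and x: "x \<in> insert None (Some ` ?J)"
    have hU: "h y \<in> carrier U" if "y \<in> insert None (Some ` ?J)" for y
      by (rule subgroup.mem_carrier[OF sub[OF that] Pi_mem[OF h that]])
    have hz: "h (Some (i, l)) \<in> generate U {z l i}" if "i \<in> I" "l \<in> {1..t}" for i l
    proof -
      have "Some (i, l) \<in> insert None (Some ` ?J)" using that by blast
      from Pi_mem[OF h this] show ?thesis unfolding H_Some[OF that] .
    qed
    have "finprod U h (insert None (Some ` ?J)) = h None \<otimes>\<^bsub>A\<^esub> finprod U h (Some ` ?J)"
      using hU finite_I by (intro U.finprod_insert) auto
    moreover have "finprod U h (Some ` ?J) = finprod U (\<lambda>y. h (Some y)) ?J"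
      using hU by (intro U.finprod_reindex) auto
    ultimately have prod: "h None \<otimes>\<^bsub>A\<^esub> finprod U (\<lambda>y. h (Some y)) ?J = \<one>\<^bsub>A\<^esub>"
      using one by simp
    have "h (Some (i, l)) \<in> W 1" if "i \<in> I" "l \<in> {1..t}" for i l
    proof -
      have "z l i \<in> W 1" using z_in_W(1)[OF that(2) I_D(1)[OF that(1)]] V_antimono[OF I_D(1)[OF that(1)]]
        by (auto simp: W_def)
      then have "generate U {z l i} \<subseteq> W 1"
        by (intro U.generate_subgroup_incl W_subgroup) auto
      then show ?thesis using hz[OF that] by blast
    qed
    then have pW: "finprod U (\<lambda>y. h (Some y)) ?J \<in> W 1"
      using finite_I by (intro W_finprod(1)) auto
    obtain m :: nat where m: "h None = const (c [^] m)" using Pi_mem[OF h, of None] C_eq by auto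
    \<comment> \<open>All other factors lie in \<open>W 1\<close> and have constant term 1, so the
      constant term of the product is that of \<open>h None\<close>.\<close>
    have "cf \<one>\<^bsub>A\<^esub> 0 = cf (h None) 0 \<otimes> cf (finprod U (\<lambda>y. h (Some y)) ?J) 0"
      unfolding prod[symmetric] using pW c(1) by (intro cf_mult_0) (auto simp: m const_closed W_D)
    moreover have "cf (finprod U (\<lambda>y. h (Some y)) ?J) 0 = \<one>"
      using pW n_ge_1 by (auto simp: W_def V_def)
    ultimately have "cf \<one>\<^bsub>A\<^esub> 0 = cf (h None) 0 \<otimes> \<one>" by (simp only:)
    then have "c [^] m = \<one>" using m c(1) n_ge_1 by (simp add: cf_one cf_const)
    then have hN: "h None = \<one>\<^bsub>A\<^esub>" using m const_one by simp
    then have "finprod U (\<lambda>y. h (Some y)) ?J = \<one>\<^bsub>A\<^esub>"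
      using prod W_D(3)[OF pW] by simp
    from z_indep[of "\<lambda>y. h (Some y)", OF hz this]
    have "h (Some (i, l)) = \<one>\<^bsub>A\<^esub>" if "i \<in> I" "l \<in> {1..t}" for i l
      using that by simp
    then show "h x = \<one>\<^bsub>A\<^esub>" using x hN by auto
  qed
  then show ?thesis using CU cyc cardC by blast
qed

end

theorem theorem4:
  fixes K :: "('a, 'b) ring_scheme" and k :: "'a set" and \<Delta> :: 'a
    and p t q n :: nat and e :: "nat \<Rightarrow> 'a" and \<alpha> :: "nat \<Rightarrow> nat \<Rightarrow> 'a"
  assumes "field K" and "subfield k K"
    and "Factorial_Ring.prime p" and "odd p" and "q = p ^ t" and "finite k" and "card k = q"
    and "ring.dimension K 2 k (carrier K)"
    and "\<Delta> \<in> carrier K" and "generate_field K (insert \<Delta> k) = carrier K"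
    and "\<Delta> [^]\<^bsub>K\<^esub> (2::nat) \<in> k"
    and "ring.independent K (generate_field K {}) (map e [1..<Suc t])"
    and "ring.Span K (generate_field K {}) (map e [1..<Suc t]) = k"
    and "\<And>l. l \<in> {1..t} \<Longrightarrow> alpha_seq K k (e l) (\<alpha> l)"
    and "n \<ge> 1" and "coprime n p"
  shows "\<exists>C. subgroup C (unitary_group K k \<Delta> n) \<and>
      cyclic_group ((unitary_group K k \<Delta> n)\<lparr>carrier := C\<rparr>) \<and>
      card C = q + 1 \<and>
      internal_direct_product (unitary_group K k \<Delta> n)
        (insert None (Some ` ({i. 1 \<le> i \<and> i \<le> n - 1 \<and> coprime i p} \<times> {1..t})))
        (case_option C (\<lambda>(i, l). H_subgroup K k \<Delta> n (\<alpha> l) i))"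
proof -
  interpret unitary_decomp K "UP K" k \<Delta> p t q e n \<alpha>
    by (intro unitary_decomp.intro quad_ext.intro quad_ext_axioms.intro unitary_decomp_axioms.intro)
      (use assms in auto)
  show ?thesis using decomposition unfolding I_def .
qed

end
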